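(* Suppose $U$ and $A$ are semigroups with maps $A\times U\to U$, $(a,u)\mapsto a\cdot u$, and $A\times U\to A$, $(a,u)\mapsto a|_u$, satisfying conditions (B1)--(B8) listed in the context. Moreover, suppose $U$ is a right LCM semigroup, $A$ is left cancellative with $\mathcal{J}(A)$ totally ordered by inclusion, and for each $a\in A$ the map $u\mapsto a\cdot u$ is a bijection from $U$ to $U$. Then the boundary quotient $\mathcal{Q}(U\bowtie A)$ is the universal $C^*$-algebra generated by an isometric representation $s$ of $A$ and a covariant representation $t$ of $U$ satisfying (K1) $s_at_u=t_{a\cdot u}s_{a|_u}$ for all $a\in A$, $u\in U$; (K2) $s_a^*t_u=t_zs_{a|_z}^*$ for all $a\in A$, $u\in U$, where $z\in U$ is the unique element satisfying $a\cdot z=u$; (Q1) $s_as_a^*=1$ for all $a\in A$; and (Q2) $\prod_{u\in F}(1-t_ut_u^* )=0$ for all foundation sets $F\subseteq U$.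
   Context: All semigroups are discrete and have an identity. A semigroup $P$ is left cancellative if $pq=pr$ implies $q=r$. For a left-cancellative $P$: $r\in P$ is a right multiple of $p$ if $r=pq$ for some $q\in P$; $r$ is a right least common multiple (right LCM) of $p,q$ if $r$ is a right common multiple of $p$ and $q$ and every right common multiple of $p$ and $q$ is a right multiple of $r$. $P$ is a right LCM semigroup if it is discrete, left cancellative, and any two elements with a right common multiple have a right LCM. For $X\subseteq P$ and $p\in P$ put $pX=\{px:x\in X\}$ and $p^{-1}X=\{y\in P:py\in X\}$. $\mathcal{J}(P)$ is the smallest family of right ideals of $P$ such that $P,\varnothing\in\mathcal{J}(P)$; $X\in\mathcal{J}(P)$ and $p\in P$ imply $pX,p^{-1}X\in\mathcal{J}(P)$; and $X,Y\in\mathcal{J}(P)$ implies $X\cap Y\in\mathcal{J}(P)$. (For a right LCM semigroup, the nonempty elements of $\mathcal{J}(P)$ are exactly the principal right ideals $pP$.) A subset $F\subseteq P$ is a foundation set if it is finite and for each $p\in P$ there exists $q\in F$ with $pP\cap qP\neq\varnothing$. For a right LCM semigroup $P$, the boundary quotient $\mathcal{Q}(P)$ is the universal $C^*$-algebra generated by isometries $\{v_p:p\in P\}$ and projections $\{e_X:X\in\mathcal{J}(P)\}$ satisfying, for all $p,q\in P$ and $X,Y\in\mathcal{J}(P)$: (1) $v_pv_q=v_{pq}$; (2) $v_pe_Xv_p^*=e_{pX}$; (3) $e_P=1$ and $e_\varnothing=0$; (4) $e_Xe_Y=e_{X\cap Y}$; and $\prod_{p\in F}(1-e_{pP})=0$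 for all foundation sets $F\subseteq P$. Conditions on the maps (with $e_A,e_U$ the identities, for all $a,b\in A$, $u,v\in U$): (B1) $e_A\cdot u=u$; (B2) $(ab)\cdot u=a\cdot(b\cdot u)$; (B3) $a\cdot e_U=e_U$; (B4) $a|_{e_U}=a$; (B5) $a\cdot(uv)=(a\cdot u)(a|_u\cdot v)$; (B6) $a|_{uv}=(a|_u)|_v$; (B7) $e_A|_u=e_A$; (B8) $(ab)|_u=a|_{b\cdot u}\,b|_u$. The (external) Zappa--Szép product $U\bowtie A$ is the set $U\times A$ with multiplication $(u,a)(v,b)=(u(a\cdot v),\,(a|_v)b)$. Under the hypotheses of the claim $U\bowtie A$ is a right LCM semigroup. An isometric representation of a semigroup $P$ in a unital $C^*$-algebra is a map $p\mapsto t_p$ into isometries with $t_pt_q=t_{pq}$. A covariant representation of a right LCM semigroup $P$ is an isometric representation $t$ such that $t_p^*t_q=t_{p'}t_{q'}^*$ whenever $pP\cap qP=rP$ and $pp'=qq'=r$, and $t_p^*t_q=0$ whenever $pP\cap qP=\varnothing$ (the right-hand side does not depend on the choice of $r$). The identification of $\mathcal{Q}(U\bowtie A)$ with this universal algebra sends $v_{(u,a)}$ to $t_us_a$ and $e_{(u,a)(U\bowtie A)}$ to $t_us_as_a^*t_u^*$. *)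

theory Defs
  imports
    "HOL-Algebra.Module"
    "HOL-Algebra.Coset"
    "HOL-Analysis.Abstract_Metric_Spaces"
begin

section \<open>Semigroups\<close>

text \<open>Semigroups have an identity and are modelled by the library's monoids. The set
  \<open>pX\<close> is the library's left coset \<open>p <# X\<close>; the principal right ideal \<open>pP\<close> is
  \<open>p <# carrier P\<close>.\<close>

definition left_cancellative :: "('p, 'm) monoid_scheme \<Rightarrow> bool" where
  "left_cancellative P \<longleftrightarrow> monoid P \<and>
     (\<forall>p\<in>carrier P. \<forall>q\<in>carrier P. \<forall>r\<in>carrier P. p \<otimes>\<^bsub>P\<^esub> q = p \<otimes>\<^bsub>P\<^esub> r \<longrightarrow> q = r)"

definition right_multiple :: "('p, 'm) monoid_scheme \<Rightarrow> 'p \<Rightarrow> 'p \<Rightarrow> bool" where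
  "right_multiple P r p \<longleftrightarrow> (\<exists>q\<in>carrier P. r = p \<otimes>\<^bsub>P\<^esub> q)"

definition right_lcm :: "('p, 'm) monoid_scheme \<Rightarrow> 'p \<Rightarrow> 'p \<Rightarrow> 'p \<Rightarrow> bool" where
  "right_lcm P r p q \<longleftrightarrow> r \<in> carrier P \<and> right_multiple P r p \<and> right_multiple P r q \<and>
     (\<forall>m\<in>carrier P. right_multiple P m p \<and> right_multiple P m q \<longrightarrow> right_multiple P m r)"

definition right_lcm_semigroup :: "('p, 'm) monoid_scheme \<Rightarrow> bool" where
  "right_lcm_semigroup P \<longleftrightarrow> left_cancellative P \<and>
     (\<forall>p\<in>carrier P. \<forall>q\<in>carrier P.
        (\<exists>m\<in>carrier P. right_multiple P m p \<and> right_multiple P m q) \<longrightarrow> (\<exists>r. right_lcm P r p q))"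

text \<open>The family \<open>\<J>(P)\<close>. Every set generated by these rules is automatically a right ideal.\<close>

inductive_set constructible_ideals :: "('p, 'm) monoid_scheme \<Rightarrow> 'p set set"
  for P :: "('p, 'm) monoid_scheme" where
    whole: "carrier P \<in> constructible_ideals P"
  | empty: "{} \<in> constructible_ideals P"
  | translate: "\<lbrakk>X \<in> constructible_ideals P; p \<in> carrier P\<rbrakk>
      \<Longrightarrow> p <#\<^bsub>P\<^esub> X \<in> constructible_ideals P"
  | preimage: "\<lbrakk>X \<in> constructible_ideals P; p \<in> carrier P\<rbrakk>
      \<Longrightarrow> {y \<in> carrier P. p \<otimes>\<^bsub>P\<^esub> y \<in> X} \<in> constructible_ideals P"
  | inter: "\<lbrakk>X \<in> constructible_ideals P; Y \<in> constructible_ideals P\<rbrakk>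
      \<Longrightarrow> X \<inter> Y \<in> constructible_ideals P"

definition foundation_set :: "('p, 'm) monoid_scheme \<Rightarrow> 'p set \<Rightarrow> bool" where
  "foundation_set P F \<longleftrightarrow> F \<subseteq> carrier P \<and> finite F \<and>
     (\<forall>p\<in>carrier P. \<exists>q\<in>F. (p <#\<^bsub>P\<^esub> carrier P) \<inter> (q <#\<^bsub>P\<^esub> carrier P) \<noteq> {})"

section \<open>Zappa--Szep products\<close>

text \<open>\<open>act a u\<close> is \<open>a \<cdot> u\<close> and \<open>res a u\<close> is \<open>a|\<^sub>u\<close>.\<close>

locale zappa_szep_pair = U: monoid U + A: monoid A
  for U :: "'u monoid" and A :: "'a monoid"
    and act :: "'a \<Rightarrow> 'u \<Rightarrow> 'u" and res :: "'a \<Rightarrow> 'u \<Rightarrow> 'a" +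
  assumes act_closed: "\<lbrakk>a \<in> carrier A; u \<in> carrier U\<rbrakk> \<Longrightarrow> act a u \<in> carrier U"
    and res_closed: "\<lbrakk>a \<in> carrier A; u \<in> carrier U\<rbrakk> \<Longrightarrow> res a u \<in> carrier A"
    and B1: "u \<in> carrier U \<Longrightarrow> act \<one>\<^bsub>A\<^esub> u = u"
    and B2: "\<lbrakk>a \<in> carrier A; b \<in> carrier A; u \<in> carrier U\<rbrakk>
      \<Longrightarrow> act (a \<otimes>\<^bsub>A\<^esub> b) u = act a (act b u)"
    and B3: "a \<in> carrier A \<Longrightarrow> act a \<one>\<^bsub>U\<^esub> = \<one>\<^bsub>U\<^esub>"
    and B4: "a \<in> carrier A \<Longrightarrow> res a \<one>\<^bsub>U\<^esub> = a"
    and B5: "\<lbrakk>a \<in> carrier A; u \<in> carrier U; v \<in> carrier U\<rbrakk>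
      \<Longrightarrow> act a (u \<otimes>\<^bsub>U\<^esub> v) = act a u \<otimes>\<^bsub>U\<^esub> act (res a u) v"
    and B6: "\<lbrakk>a \<in> carrier A; u \<in> carrier U; v \<in> carrier U\<rbrakk>
      \<Longrightarrow> res a (u \<otimes>\<^bsub>U\<^esub> v) = res (res a u) v"
    and B7: "u \<in> carrier U \<Longrightarrow> res \<one>\<^bsub>A\<^esub> u = \<one>\<^bsub>A\<^esub>"
    and B8: "\<lbrakk>a \<in> carrier A; b \<in> carrier A; u \<in> carrier U\<rbrakk>
      \<Longrightarrow> res (a \<otimes>\<^bsub>A\<^esub> b) u = res a (act b u) \<otimes>\<^bsub>A\<^esub> res b u"

definition zappa_szep ::
    "'u monoid \<Rightarrow> 'a monoid \<Rightarrow> ('a \<Rightarrow> 'u \<Rightarrow> 'u) \<Rightarrow> ('a \<Rightarrow> 'u \<Rightarrow> 'a) \<Rightarrow> ('u \<times> 'a) monoid" where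
  "zappa_szep U A act res =
     \<lparr>carrier = carrier U \<times> carrier A,
      monoid.mult = (\<lambda>(u, a) (v, b). (u \<otimes>\<^bsub>U\<^esub> act a v, res a v \<otimes>\<^bsub>A\<^esub> b)),
      one = (\<one>\<^bsub>U\<^esub>, \<one>\<^bsub>A\<^esub>)\<rparr>"

section \<open>Unital C*-algebras\<close>

record 'b cstar = "(complex, 'b) module" +
  cstar_adj :: "'b \<Rightarrow> 'b" (\<open>(_\<^sup>\<star>\<index>)\<close> [1000] 999)
  cstar_norm :: "'b \<Rightarrow> real"

definition complex_field :: "complex ring" where
  "complex_field = \<lparr>carrier = UNIV, monoid.mult = (*), one = 1, zero = 0, add = (+)\<rparr>"

definition cstar_dist :: "'b cstar \<Rightarrow> 'b \<Rightarrow> 'b \<Rightarrow> real" where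
  "cstar_dist B x y = cstar_norm B (x \<ominus>\<^bsub>B\<^esub> y)"

text \<open>The zero algebra, where \<open>\<one> = \<zero>\<close>, is admitted.\<close>

locale unital_cstar_algebra = ring B + Module.module complex_field B
  for B :: "'b cstar" (structure) +
  assumes smult_mult_left: "\<lbrakk>x \<in> carrier B; y \<in> carrier B\<rbrakk> \<Longrightarrow> (c \<odot> x) \<otimes> y = c \<odot> (x \<otimes> y)"
    and smult_mult_right: "\<lbrakk>x \<in> carrier B; y \<in> carrier B\<rbrakk> \<Longrightarrow> x \<otimes> (c \<odot> y) = c \<odot> (x \<otimes> y)"
    and adj_closed: "x \<in> carrier B \<Longrightarrow> x\<^sup>\<star> \<in> carrier B"
    and adj_adj: "x \<in> carrier B \<Longrightarrow> (x\<^sup>\<star>)\<^sup>\<star> = x"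
    and adj_add: "\<lbrakk>x \<in> carrier B; y \<in> carrier B\<rbrakk> \<Longrightarrow> (x \<oplus> y)\<^sup>\<star> = x\<^sup>\<star> \<oplus> y\<^sup>\<star>"
    and adj_mult: "\<lbrakk>x \<in> carrier B; y \<in> carrier B\<rbrakk> \<Longrightarrow> (x \<otimes> y)\<^sup>\<star> = y\<^sup>\<star> \<otimes> x\<^sup>\<star>"
    and adj_smult: "x \<in> carrier B \<Longrightarrow> (c \<odot> x)\<^sup>\<star> = cnj c \<odot> x\<^sup>\<star>"
    and norm_nonneg: "x \<in> carrier B \<Longrightarrow> 0 \<le> cstar_norm B x"
    and norm_eq_0: "x \<in> carrier B \<Longrightarrow> cstar_norm B x = 0 \<longleftrightarrow> x = \<zero>"
    and norm_triangle: "\<lbrakk>x \<in> carrier B; y \<in> carrier B\<rbrakk>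
      \<Longrightarrow> cstar_norm B (x \<oplus> y) \<le> cstar_norm B x + cstar_norm B y"
    and norm_smult: "x \<in> carrier B \<Longrightarrow> cstar_norm B (c \<odot> x) = cmod c * cstar_norm B x"
    and norm_mult: "\<lbrakk>x \<in> carrier B; y \<in> carrier B\<rbrakk>
      \<Longrightarrow> cstar_norm B (x \<otimes> y) \<le> cstar_norm B x * cstar_norm B y"
    and cstar_identity: "x \<in> carrier B \<Longrightarrow> cstar_norm B (x\<^sup>\<star> \<otimes> x) = (cstar_norm B x)\<^sup>2"
    and complete: "Metric_space.mcomplete (carrier B) (cstar_dist B)"

text \<open>Unital *-homomorphisms: \<open>ring_hom\<close> includes preservation of \<open>\<one>\<close>.\<close>

definition cstar_hom :: "'b cstar \<Rightarrow> 'c cstar \<Rightarrow> ('b \<Rightarrow> 'c) set" where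
  "cstar_hom B C = {\<phi> \<in> ring_hom B C. \<forall>x\<in>carrier B.
     (\<forall>c. \<phi> (c \<odot>\<^bsub>B\<^esub> x) = c \<odot>\<^bsub>C\<^esub> \<phi> x) \<and> \<phi> (x\<^sup>\<star>\<^bsub>B\<^esub>) = (\<phi> x)\<^sup>\<star>\<^bsub>C\<^esub>}"

definition cstar_subalgebra :: "'b cstar \<Rightarrow> 'b set \<Rightarrow> bool" where
  "cstar_subalgebra B D \<longleftrightarrow> D \<subseteq> carrier B \<and> \<zero>\<^bsub>B\<^esub> \<in> D \<and>
     (\<forall>x\<in>D. \<forall>y\<in>D. x \<oplus>\<^bsub>B\<^esub> y \<in> D \<and> x \<otimes>\<^bsub>B\<^esub> y \<in> D) \<and>
     (\<forall>x\<in>D. x\<^sup>\<star>\<^bsub>B\<^esub> \<in> D \<and> (\<forall>c. c \<odot>\<^bsub>B\<^esub> x \<in> D)) \<and>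
     closedin (Metric_space.mtopology (carrier B) (cstar_dist B)) D"

definition cstar_generated_by :: "'b cstar \<Rightarrow> 'b set \<Rightarrow> bool" where
  "cstar_generated_by B S \<longleftrightarrow> S \<subseteq> carrier B \<and>
     (\<forall>D. cstar_subalgebra B D \<and> S \<subseteq> D \<longrightarrow> D = carrier B)"

section \<open>Representations and universal algebras\<close>

locale isometric_representation = unital_cstar_algebra B
  for P :: "('p, 'm) monoid_scheme" and B :: "'b cstar" (structure) and t :: "'p \<Rightarrow> 'b" +
  assumes rep_closed: "p \<in> carrier P \<Longrightarrow> t p \<in> carrier B"
    and rep_isometry: "p \<in> carrier P \<Longrightarrow> (t p)\<^sup>\<star> \<otimes> t p = \<one>"
    and rep_mult: "\<lbrakk>p \<in> carrier P; q \<in> carrier P\<rbrakk> \<Longrightarrow> t p \<otimes> t q = t (p \<otimes>\<^bsub>P\<^esub> q)"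

locale covariant_representation = isometric_representation P B t
  for P :: "('p, 'm) monoid_scheme" and B :: "'b cstar" (structure) and t :: "'p \<Rightarrow> 'b" +
  assumes covariant_lcm:
    "\<lbrakk>p \<in> carrier P; q \<in> carrier P; r \<in> carrier P; p' \<in> carrier P; q' \<in> carrier P;
      (p <#\<^bsub>P\<^esub> carrier P) \<inter> (q <#\<^bsub>P\<^esub> carrier P) = r <#\<^bsub>P\<^esub> carrier P;
      p \<otimes>\<^bsub>P\<^esub> p' = r; q \<otimes>\<^bsub>P\<^esub> q' = r\<rbrakk>
      \<Longrightarrow> (t p)\<^sup>\<star> \<otimes> t q = t p' \<otimes> (t q')\<^sup>\<star>"
    and covariant_disjoint:
    "\<lbrakk>p \<in> carrier P; q \<in> carrier P;
      (p <#\<^bsub>P\<^esub> carrier P) \<inter> (q <#\<^bsub>P\<^esub> carrier P) = {}\<rbrakk>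
      \<Longrightarrow> (t p)\<^sup>\<star> \<otimes> t q = \<zero>"

text \<open>\<open>defect_product B f [p\<^sub>1, \<dots>, p\<^sub>n]\<close> is \<open>(1 - f p\<^sub>1) \<cdots> (1 - f p\<^sub>n)\<close>. Products over a
  finite set are rendered by the products over all its enumerations: in the situations below the
  factors commute, so these all agree, but \<open>finprod\<close> needs a commutative monoid.\<close>

definition defect_product :: "'b cstar \<Rightarrow> ('p \<Rightarrow> 'b) \<Rightarrow> 'p list \<Rightarrow> 'b" where
  "defect_product B f ps = foldr (\<lambda>p x. (\<one>\<^bsub>B\<^esub> \<ominus>\<^bsub>B\<^esub> f p) \<otimes>\<^bsub>B\<^esub> x) ps \<one>\<^bsub>B\<^esub>"

text \<open>The defining relations of \<open>\<Q>(P)\<close>; only the values of \<open>e\<close> on \<open>\<J>(P)\<close> matter.\<close>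

locale boundary_relations = isometric_representation P B v
  for P :: "'p monoid" and B :: "'b cstar" (structure)
    and v :: "'p \<Rightarrow> 'b" and e :: "'p set \<Rightarrow> 'b" +
  assumes e_closed: "X \<in> constructible_ideals P \<Longrightarrow> e X \<in> carrier B"
    and e_idem: "X \<in> constructible_ideals P \<Longrightarrow> e X \<otimes> e X = e X"
    and e_adj: "X \<in> constructible_ideals P \<Longrightarrow> (e X)\<^sup>\<star> = e X"
    and e_translate: "\<lbrakk>p \<in> carrier P; X \<in> constructible_ideals P\<rbrakk>
      \<Longrightarrow> v p \<otimes> e X \<otimes> (v p)\<^sup>\<star> = e (p <#\<^bsub>P\<^esub> X)"
    and e_whole: "e (carrier P) = \<one>"
    and e_empty: "e {} = \<zero>"
    and e_inter: "\<lbrakk>X \<in> constructible_ideals P; Y \<in> constructible_ideals P\<rbrakk>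
      \<Longrightarrow> e X \<otimes> e Y = e (X \<inter> Y)"
    and e_foundation: "\<lbrakk>foundation_set P F; set ps = F; distinct ps\<rbrakk>
      \<Longrightarrow> defect_product B (\<lambda>p. e (p <#\<^bsub>P\<^esub> carrier P)) ps = \<zero>"

locale zappa_szep_relations =
    s: isometric_representation A B s + t: covariant_representation U B t
  for U :: "'u monoid" and A :: "'a monoid"
    and act :: "'a \<Rightarrow> 'u \<Rightarrow> 'u" and res :: "'a \<Rightarrow> 'u \<Rightarrow> 'a"
    and B :: "'b cstar" (structure) and s :: "'a \<Rightarrow> 'b" and t :: "'u \<Rightarrow> 'b" +
  assumes K1: "\<lbrakk>a \<in> carrier A; u \<in> carrier U\<rbrakk>
      \<Longrightarrow> s a \<otimes> t u = t (act a u) \<otimes> s (res a u)"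
    and K2: "\<lbrakk>a \<in> carrier A; u \<in> carrier U; z \<in> carrier U; act a z = u\<rbrakk>
      \<Longrightarrow> (s a)\<^sup>\<star> \<otimes> t u = t z \<otimes> (s (res a z))\<^sup>\<star>"
    and Q1: "a \<in> carrier A \<Longrightarrow> s a \<otimes> (s a)\<^sup>\<star> = \<one>"
    and Q2: "\<lbrakk>foundation_set U F; set us = F; distinct us\<rbrakk>
      \<Longrightarrow> defect_product B (\<lambda>u. t u \<otimes> (t u)\<^sup>\<star>) us = \<zero>"

text \<open>The two universal C*-algebras, given by their universal properties. A bound variable cannot
  range over types, so the type carrying the test algebras \<open>B\<close> is an explicit argument; a
  statement with a free type variable there holds for test algebras on every type.\<close>

definition is_boundary_quotient ::
    "'b itself \<Rightarrow> 'p monoid \<Rightarrow> 'q cstar \<Rightarrow> ('p \<Rightarrow> 'q) \<Rightarrow> ('p set \<Rightarrow> 'q) \<Rightarrow> bool" where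
  "is_boundary_quotient (T :: 'b itself) P Q v e \<longleftrightarrow>
     boundary_relations P Q v e \<and>
     cstar_generated_by Q (v ` carrier P \<union> e ` constructible_ideals P) \<and>
     (\<forall>(B :: 'b cstar) v' e'. boundary_relations P B v' e' \<longrightarrow>
       (\<exists>\<phi>\<in>cstar_hom Q B.
          (\<forall>p\<in>carrier P. \<phi> (v p) = v' p) \<and> (\<forall>X\<in>constructible_ideals P. \<phi> (e X) = e' X) \<and>
          (\<forall>\<psi>\<in>cstar_hom Q B.
             (\<forall>p\<in>carrier P. \<psi> (v p) = v' p) \<and> (\<forall>X\<in>constructible_ideals P. \<psi> (e X) = e' X)
             \<longrightarrow> (\<forall>x\<in>carrier Q. \<psi> x = \<phi> x))))"

definition is_universal_zappa_szep ::
    "'b itself \<Rightarrow> 'u monoid \<Rightarrow> 'a monoid \<Rightarrow> ('a \<Rightarrow> 'u \<Rightarrow> 'u) \<Rightarrow> ('a \<Rightarrow> 'u \<Rightarrow> 'a)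
       \<Rightarrow> 'q cstar \<Rightarrow> ('a \<Rightarrow> 'q) \<Rightarrow> ('u \<Rightarrow> 'q) \<Rightarrow> bool" where
  "is_universal_zappa_szep (T :: 'b itself) U A act res Q s t \<longleftrightarrow>
     zappa_szep_relations U A act res Q s t \<and>
     cstar_generated_by Q (s ` carrier A \<union> t ` carrier U) \<and>
     (\<forall>(B :: 'b cstar) s' t'. zappa_szep_relations U A act res B s' t' \<longrightarrow>
       (\<exists>\<phi>\<in>cstar_hom Q B.
          (\<forall>a\<in>carrier A. \<phi> (s a) = s' a) \<and> (\<forall>u\<in>carrier U. \<phi> (t u) = t' u) \<and>
          (\<forall>\<psi>\<in>cstar_hom Q B.
             (\<forall>a\<in>carrier A. \<psi> (s a) = s' a) \<and> (\<forall>u\<in>carrier U. \<psi> (t u) = t' u)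
             \<longrightarrow> (\<forall>x\<in>carrier Q. \<psi> x = \<phi> x))))"

definition zappa_szep_identification ::
    "'u monoid \<Rightarrow> 'a monoid \<Rightarrow> ('a \<Rightarrow> 'u \<Rightarrow> 'u) \<Rightarrow> ('a \<Rightarrow> 'u \<Rightarrow> 'a) \<Rightarrow> 'q cstar
       \<Rightarrow> ('u \<times> 'a \<Rightarrow> 'q) \<Rightarrow> (('u \<times> 'a) set \<Rightarrow> 'q) \<Rightarrow> ('a \<Rightarrow> 'q) \<Rightarrow> ('u \<Rightarrow> 'q) \<Rightarrow> bool" where
  "zappa_szep_identification U A act res Q v e s t \<longleftrightarrow>
     (let P = zappa_szep U A act res in
      \<forall>u\<in>carrier U. \<forall>a\<in>carrier A.
        v (u, a) = t u \<otimes>\<^bsub>Q\<^esub> s a \<and>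
        e ((u, a) <#\<^bsub>P\<^esub> carrier P) = t u \<otimes>\<^bsub>Q\<^esub> s a \<otimes>\<^bsub>Q\<^esub> (s a)\<^sup>\<star>\<^bsub>Q\<^esub> \<otimes>\<^bsub>Q\<^esub> (t u)\<^sup>\<star>\<^bsub>Q\<^esub>)"

end

theory Submission
  imports Defs "HOL-Algebra.Multiplicative_Group"
begin

text \<open>Write \<open>P\<close> for the Zappa--Szep product. Fix a C*-algebra \<open>B\<close>. The theorem says that the
  solutions in \<open>B\<close> of the two systems of relations are in bijection, by
  \<open>v (u, a) = t u s a\<close>, that is \<open>s a = v (1, a)\<close> and \<open>t u = v (u, 1)\<close>; the bijection is natural in
  \<open>B\<close> and preserves the C*-subalgebra generated, so one universal property is the other one
  (\<open>matching_universal_iff\<close>).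

  What makes the bijection work is that the ideal structure of \<open>P\<close> is that of \<open>U\<close>. Since the
  action is by bijections, \<open>(u, a)P\<close> projects onto \<open>uU\<close>. If \<open>uU \<inter> vU = wU\<close>, then the part of
  \<open>(u, a)P\<close> lying over \<open>wU\<close> is \<open>(w, c)P\<close> with \<open>c\<close> a restriction of \<open>a\<close>, and likewise
  \<open>(w, d)P\<close> for \<open>(v, b)P\<close>; as principal right ideals of \<open>A\<close> form a chain, one of these contains
  the other. So \<open>(u, a)P \<inter> (v, b)P\<close> is principal over \<open>wU\<close>, and it is empty exactly when
  \<open>uU \<inter> vU\<close> is. Consequently \<open>\<J>(P)\<close> consists of \<open>\<emptyset>\<close> and the principal right ideals
  (\<open>P_constructible_cases\<close>), and a finite \<open>F \<subseteq> P\<close> is a foundation set iff its projection to \<open>U\<close> is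
  one (\<open>foundation_set_fst_iff\<close>).

  From \<open>(v, e)\<close> to \<open>(s, t)\<close>: covariance of \<open>t\<close> is inherited from \<open>v\<close>, (K1) is multiplicativity of
  \<open>v\<close>, and every \<open>{(1, a)}\<close> is a foundation set, which gives (Q1); (K2) follows from
  (K1) and (Q1). From \<open>(s, t)\<close> to \<open>(v, e)\<close>: by (Q1) the range projection of \<open>v (u, a)\<close> is
  \<open>t u (t u)\<^sup>*\<close>, so a projection depending only on the image of an ideal in \<open>U\<close> can serve as
  \<open>e\<close>, and the relations for \<open>e\<close> are those for range projections of a covariant representation of
  \<open>U\<close>.\<close>

section \<open>Principal right ideals\<close>

lemma left_cancellativeD:
  assumes "left_cancellative P" "p \<otimes>\<^bsub>P\<^esub> q = p \<otimes>\<^bsub>P\<^esub> r"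
    and "p \<in> carrier P" "q \<in> carrier P" "r \<in> carrier P"
  shows "q = r"
  using assms unfolding left_cancellative_def by blast

lemma principal_mem_iff:
  "x \<in> p <#\<^bsub>P\<^esub> carrier P \<longleftrightarrow> (\<exists>q\<in>carrier P. x = p \<otimes>\<^bsub>P\<^esub> q)"
  unfolding l_coset_def by auto

lemma (in monoid) principal_self: "p \<in> carrier G \<Longrightarrow> p \<in> p <# carrier G"
  unfolding principal_mem_iff by (metis one_closed r_one)

lemma (in monoid) principal_mult_subset:
  "\<lbrakk>p \<in> carrier G; q \<in> carrier G\<rbrakk> \<Longrightarrow> (p \<otimes> q) <# carrier G \<subseteq> p <# carrier G"
  unfolding l_coset_def by (auto simp: m_assoc)

lemma (in monoid) translate_principal:
  "\<lbrakk>p \<in> carrier G; q \<in> carrier G\<rbrakk> \<Longrightarrow> p <# (q <# carrier G) = (p \<otimes> q) <# carrier G"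
  by (auto simp: l_coset_def m_assoc)

lemma (in monoid) principal_constructible:
  "p \<in> carrier G \<Longrightarrow> p <# carrier G \<in> constructible_ideals G"
  by (intro constructible_ideals.translate constructible_ideals.whole)

lemma right_lcm_semigroup_principal_inter:
  assumes "right_lcm_semigroup P" and p: "p \<in> carrier P" and q: "q \<in> carrier P"
    and ne: "(p <#\<^bsub>P\<^esub> carrier P) \<inter> (q <#\<^bsub>P\<^esub> carrier P) \<noteq> {}"
  shows "\<exists>r\<in>carrier P. (p <#\<^bsub>P\<^esub> carrier P) \<inter> (q <#\<^bsub>P\<^esub> carrier P) = r <#\<^bsub>P\<^esub> carrier P"
proof -
  interpret monoid P
    using assms(1) unfolding right_lcm_semigroup_def left_cancellative_def by blast
  have multiple: "right_multiple P x y \<longleftrightarrow> x \<in> y <#\<^bsub>P\<^esub> carrier P" for x y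
    unfolding right_multiple_def principal_mem_iff ..
  have closed: "x \<in> carrier P" if "x \<in> y <#\<^bsub>P\<^esub> carrier P" "y \<in> carrier P" for x y
    using that unfolding principal_mem_iff by auto
  obtain r where r: "right_lcm P r p q"
    using assms(1) ne p q closed unfolding right_lcm_semigroup_def multiple by blast
  then obtain p' q' where pq: "r \<in> carrier P" "p' \<in> carrier P" "q' \<in> carrier P"
      "r = p \<otimes>\<^bsub>P\<^esub> p'" "r = q \<otimes>\<^bsub>P\<^esub> q'"
    unfolding right_lcm_def right_multiple_def by blast
  have "r <#\<^bsub>P\<^esub> carrier P \<subseteq> (p <#\<^bsub>P\<^esub> carrier P) \<inter> (q <#\<^bsub>P\<^esub> carrier P)"
    using principal_mult_subset[OF p pq(2)] principal_mult_subset[OF q pq(3)] pq(4,5) by simp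
  moreover have "(p <#\<^bsub>P\<^esub> carrier P) \<inter> (q <#\<^bsub>P\<^esub> carrier P) \<subseteq> r <#\<^bsub>P\<^esub> carrier P"
    using r closed p unfolding right_lcm_def multiple by blast
  ultimately show ?thesis using pq(1) by blast
qed

lemma preimage_eq_principal:
  assumes lc: "left_cancellative P" and p: "p \<in> carrier P" and q: "q \<in> carrier P"
    and X: "(p <#\<^bsub>P\<^esub> carrier P) \<inter> X = (p \<otimes>\<^bsub>P\<^esub> q) <#\<^bsub>P\<^esub> carrier P"
  shows "{y \<in> carrier P. p \<otimes>\<^bsub>P\<^esub> y \<in> X} = q <#\<^bsub>P\<^esub> carrier P"
proof (intro Set.set_eqI iffI)
  interpret monoid P
    using lc unfolding left_cancellative_def by blast
  fix y
  show "y \<in> q <#\<^bsub>P\<^esub> carrier P" if "y \<in> {y \<in> carrier P. p \<otimes>\<^bsub>P\<^esub> y \<in> X}"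
  proof -
    have y: "y \<in> carrier P" "p \<otimes>\<^bsub>P\<^esub> y \<in> X"
      using that by simp_all
    have "p \<otimes>\<^bsub>P\<^esub> y \<in> p <#\<^bsub>P\<^esub> carrier P"
      unfolding principal_mem_iff using y(1) by blast
    with y(2) have "p \<otimes>\<^bsub>P\<^esub> y \<in> (p \<otimes>\<^bsub>P\<^esub> q) <#\<^bsub>P\<^esub> carrier P"
      using X by blast
    then obtain k where k: "k \<in> carrier P" "p \<otimes>\<^bsub>P\<^esub> y = p \<otimes>\<^bsub>P\<^esub> q \<otimes>\<^bsub>P\<^esub> k"
      unfolding principal_mem_iff by blast
    have "p \<otimes>\<^bsub>P\<^esub> y = p \<otimes>\<^bsub>P\<^esub> (q \<otimes>\<^bsub>P\<^esub> k)"
      using k p q by (simp add: m_assoc)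
    then have "y = q \<otimes>\<^bsub>P\<^esub> k"
      by (rule left_cancellativeD[OF lc _ p y(1) m_closed[OF q k(1)]])
    then show ?thesis
      unfolding principal_mem_iff using k(1) by blast
  qed
  show "y \<in> {y \<in> carrier P. p \<otimes>\<^bsub>P\<^esub> y \<in> X}" if y: "y \<in> q <#\<^bsub>P\<^esub> carrier P"
  proof -
    obtain k where k: "k \<in> carrier P" "y = q \<otimes>\<^bsub>P\<^esub> k"
      using y unfolding principal_mem_iff by blast
    have "p \<otimes>\<^bsub>P\<^esub> y = p \<otimes>\<^bsub>P\<^esub> q \<otimes>\<^bsub>P\<^esub> k"
      using k p q by (simp add: m_assoc)
    then have "p \<otimes>\<^bsub>P\<^esub> y \<in> (p \<otimes>\<^bsub>P\<^esub> q) <#\<^bsub>P\<^esub> carrier P"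
      unfolding principal_mem_iff using k(1) by blast
    then show ?thesis
      using k q X by auto
  qed
qed

text \<open>The argument is an induction on the generation of \<open>\<J>(P)\<close>, in which only the preimages need
  work: \<open>p\<^sup>-\<^sup>1(qP)\<close> depends only on \<open>pP \<inter> qP\<close>, a principal ideal \<open>(pp')P\<close>, and so equals \<open>p'P\<close> by
  left cancellation.\<close>

lemma constructible_ideals_principal:
  assumes lc: "left_cancellative P"
    and inter: "\<And>p q. \<lbrakk>p \<in> carrier P; q \<in> carrier P;
        (p <#\<^bsub>P\<^esub> carrier P) \<inter> (q <#\<^bsub>P\<^esub> carrier P) \<noteq> {}\<rbrakk>
      \<Longrightarrow> \<exists>r\<in>carrier P. (p <#\<^bsub>P\<^esub> carrier P) \<inter> (q <#\<^bsub>P\<^esub> carrier P) = r <#\<^bsub>P\<^esub> carrier P"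
    and "X \<in> constructible_ideals P" and "X \<noteq> {}"
  shows "\<exists>p\<in>carrier P. X = p <#\<^bsub>P\<^esub> carrier P"
proof -
  interpret monoid P
    using lc unfolding left_cancellative_def by blast
  from assms(3) have "X = {} \<or> (\<exists>p\<in>carrier P. X = p <#\<^bsub>P\<^esub> carrier P)"
  proof induction
    case whole
    have "carrier P = \<one>\<^bsub>P\<^esub> <#\<^bsub>P\<^esub> carrier P"
      by (auto simp: l_coset_def)
    then show ?case using one_closed by blast
  next
    case empty
    show ?case by simp
  next
    case (translate X p)
    then show ?case
      by (auto simp: translate_principal) (auto simp: l_coset_def)
  next
    case (preimage X p)
    show ?case
    proof (cases "{y \<in> carrier P. p \<otimes>\<^bsub>P\<^esub> y \<in> X} = {}")
      case False
      then obtain q where q: "q \<in> carrier P" "X = q <#\<^bsub>P\<^esub> carrier P"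
        using preimage.IH by blast
      obtain y where "y \<in> carrier P" "p \<otimes>\<^bsub>P\<^esub> y \<in> X"
        using False by blast
      then have "p \<otimes>\<^bsub>P\<^esub> y \<in> (p <#\<^bsub>P\<^esub> carrier P) \<inter> (q <#\<^bsub>P\<^esub> carrier P)"
        unfolding q(2) by (auto simp: principal_mem_iff)
      then have "(p <#\<^bsub>P\<^esub> carrier P) \<inter> (q <#\<^bsub>P\<^esub> carrier P) \<noteq> {}"
        by blast
      then obtain r where r: "r \<in> carrier P"
          "(p <#\<^bsub>P\<^esub> carrier P) \<inter> X = r <#\<^bsub>P\<^esub> carrier P"
        using inter[OF preimage.hyps(2) q(1)] q(2) by blast
      then obtain p' where p': "p' \<in> carrier P" "r = p \<otimes>\<^bsub>P\<^esub> p'"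
        using principal_self[OF r(1)] unfolding r(2)[symmetric] Int_iff principal_mem_iff by blast
      have "{y \<in> carrier P. p \<otimes>\<^bsub>P\<^esub> y \<in> X} = p' <#\<^bsub>P\<^esub> carrier P"
        using preimage_eq_principal[OF lc preimage.hyps(2) p'(1)] r(2) p'(2) by simp
      then show ?thesis using p'(1) by blast
    qed simp
  next
    case (inter X Y)
    then show ?case using assms(2) by blast
  qed
  then show ?thesis using assms(4) by blast
qed

section \<open>Isometries and commuting projections\<close>

text \<open>In \<open>unital_cstar_algebra\<close> the unqualified ring laws of the locale \<open>module\<close> speak about the
  field of scalars; these two facts recover them for \<open>B\<close> itself.\<close>

lemma (in unital_cstar_algebra) B_ring: "ring B"
  by unfold_locales

lemmas (in unital_cstar_algebra) mult_assoc = monoid.m_assoc[OF ring.is_monoid[OF B_ring]]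

lemma (in isometric_representation) rep_one:
  assumes "monoid P"
  shows "t \<one>\<^bsub>P\<^esub> = \<one>"
proof -
  interpret P: monoid P by fact
  have c: "t \<one>\<^bsub>P\<^esub> \<in> carrier B" "(t \<one>\<^bsub>P\<^esub>)\<^sup>\<star> \<in> carrier B"
    by (simp_all add: rep_closed adj_closed)
  have "t \<one>\<^bsub>P\<^esub> = (t \<one>\<^bsub>P\<^esub>)\<^sup>\<star> \<otimes> t \<one>\<^bsub>P\<^esub> \<otimes> t \<one>\<^bsub>P\<^esub>"
    using c by (simp add: rep_isometry)
  also have "\<dots> = (t \<one>\<^bsub>P\<^esub>)\<^sup>\<star> \<otimes> t \<one>\<^bsub>P\<^esub>"
    using c by (simp add: mult_assoc rep_mult)
  finally show ?thesis by (simp add: rep_isometry)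
qed

lemma (in isometric_representation) rep_cancel:
  assumes "p \<in> carrier P" "x \<in> carrier B"
  shows "(t p)\<^sup>\<star> \<otimes> (t p \<otimes> x) = x"
  using assms by (simp add: rep_closed adj_closed rep_isometry flip: mult_assoc)

lemma (in unital_cstar_algebra) adj_zero: "\<zero>\<^sup>\<star> = \<zero>"
proof -
  have "\<zero>\<^sup>\<star> = (\<zero>\<^sup>\<star> \<otimes> \<zero>)\<^sup>\<star>"
    by (simp add: adj_closed)
  also have "\<dots> = \<zero>\<^sup>\<star> \<otimes> (\<zero>\<^sup>\<star>)\<^sup>\<star>"
    by (rule adj_mult) (simp_all add: adj_closed)
  also have "\<dots> = \<zero>"
    by (simp add: adj_closed adj_adj)
  finally show ?thesis .
qed

lemma defect_product_map:
  "defect_product B f (map g xs) = defect_product B (\<lambda>x. f (g x)) xs"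
  by (induction xs) (simp_all add: defect_product_def)

lemma defect_product_cong:
  "(\<And>x. x \<in> set xs \<Longrightarrow> f x = g x) \<Longrightarrow> defect_product B f xs = defect_product B g xs"
  by (induction xs) (simp_all add: defect_product_def)

lemma (in ring) minus_one_idem:
  assumes "x \<in> carrier R" "x \<otimes> x = x"
  shows "(\<one> \<ominus> x) \<otimes> (\<one> \<ominus> x) = \<one> \<ominus> x"
  using assms by (simp add: a_minus_def l_distr r_distr l_minus r_minus a_assoc r_neg minus_minus)

lemma (in ring) minus_one_comm:
  assumes "x \<in> carrier R" "y \<in> carrier R" "x \<otimes> y = y \<otimes> x"
  shows "(\<one> \<ominus> x) \<otimes> (\<one> \<ominus> y) = (\<one> \<ominus> y) \<otimes> (\<one> \<ominus> x)"
  using assms by (simp add: a_minus_def l_distr r_distr l_minus r_minus minus_add a_ac)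

context unital_cstar_algebra
begin

lemma defect_product_closed:
  "(\<And>x. x \<in> set xs \<Longrightarrow> f x \<in> carrier B) \<Longrightarrow> defect_product B f xs \<in> carrier B"
  by (induction xs) (simp_all add: defect_product_def)

lemma defect_product_absorb:
  assumes "\<And>x. x \<in> set xs \<Longrightarrow> f x \<in> carrier B"
    and "\<And>x. x \<in> set xs \<Longrightarrow> f x \<otimes> f x = f x"
    and "\<And>x y. \<lbrakk>x \<in> set xs; y \<in> set xs\<rbrakk> \<Longrightarrow> f x \<otimes> f y = f y \<otimes> f x"
    and "z \<in> set xs"
  shows "(\<one> \<ominus> f z) \<otimes> defect_product B f xs = defect_product B f xs"
  using assms
proof (induction xs)
  case (Cons x xs)
  let ?D = "defect_product B f xs"
  have c: "\<one> \<ominus> f x \<in> carrier B" "\<one> \<ominus> f z \<in> carrier B" "?D \<in> carrier B"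
    using Cons.prems by (auto intro!: defect_product_closed)
  have D: "defect_product B f (x # xs) = (\<one> \<ominus> f x) \<otimes> ?D"
    by (simp add: defect_product_def)
  show ?case
  proof (cases "z = x")
    case True
    then show ?thesis
      unfolding D using c ring.minus_one_idem[OF B_ring, of "f x"] Cons.prems by (simp flip: mult_assoc)
  next
    case False
    then have "(\<one> \<ominus> f z) \<otimes> ?D = ?D"
      using Cons.prems by (intro Cons.IH) auto
    moreover have "(\<one> \<ominus> f z) \<otimes> (\<one> \<ominus> f x) = (\<one> \<ominus> f x) \<otimes> (\<one> \<ominus> f z)"
      using Cons.prems by (intro ring.minus_one_comm[OF B_ring]) auto
    ultimately show ?thesis
      unfolding D using c by (simp flip: mult_assoc) (simp add: mult_assoc)
  qed
qed simp

text \<open>Distinct elements of a foundation set of the Zappa--Szep product may have the same first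
  component, so projecting an enumeration to \<open>U\<close> creates repetitions; for commuting idempotents
  these do not change the product.\<close>

lemma defect_product_remdups:
  assumes "\<And>x. x \<in> set xs \<Longrightarrow> f x \<in> carrier B"
    and "\<And>x. x \<in> set xs \<Longrightarrow> f x \<otimes> f x = f x"
    and "\<And>x y. \<lbrakk>x \<in> set xs; y \<in> set xs\<rbrakk> \<Longrightarrow> f x \<otimes> f y = f y \<otimes> f x"
  shows "defect_product B f (remdups xs) = defect_product B f xs"
  using assms
proof (induction xs)
  case (Cons x xs)
  have IH: "defect_product B f (remdups xs) = defect_product B f xs"
    using Cons.prems by (intro Cons.IH) auto
  have D: "defect_product B f (x # ys) = (\<one> \<ominus> f x) \<otimes> defect_product B f ys" for ys
    by (simp add: defect_product_def)
  show ?case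
  proof (cases "x \<in> set xs")
    case True
    then have "(\<one> \<ominus> f x) \<otimes> defect_product B f xs = defect_product B f xs"
      using Cons.prems by (intro defect_product_absorb) auto
    then show ?thesis
      using True IH by (simp add: D)
  next
    case False
    then show ?thesis
      using IH by (simp add: D)
  qed
qed simp

end

context isometric_representation
begin

definition range_proj where
  "range_proj p = t p \<otimes> (t p)\<^sup>\<star>"

lemma range_proj_closed: "p \<in> carrier P \<Longrightarrow> range_proj p \<in> carrier B"
  by (simp add: range_proj_def rep_closed adj_closed)

lemma range_proj_adj: "p \<in> carrier P \<Longrightarrow> (range_proj p)\<^sup>\<star> = range_proj p"
  by (simp add: range_proj_def rep_closed adj_closed adj_mult adj_adj)

lemma range_proj_idem: "p \<in> carrier P \<Longrightarrow> range_proj p \<otimes> range_proj p = range_proj p"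
  by (simp add: range_proj_def rep_closed adj_closed mult_assoc rep_cancel)

lemma range_proj_mult:
  assumes "p \<in> carrier P" "q \<in> carrier P"
  shows "range_proj (p \<otimes>\<^bsub>P\<^esub> q) = t p \<otimes> range_proj q \<otimes> (t p)\<^sup>\<star>"
  using assms by (simp add: range_proj_def rep_closed adj_closed adj_mult mult_assoc flip: rep_mult)

end

context covariant_representation
begin

lemma range_proj_inter:
  assumes P: "monoid P" and pqr: "p \<in> carrier P" "q \<in> carrier P" "r \<in> carrier P"
    and r: "(p <#\<^bsub>P\<^esub> carrier P) \<inter> (q <#\<^bsub>P\<^esub> carrier P) = r <#\<^bsub>P\<^esub> carrier P"
  shows "range_proj p \<otimes> range_proj q = range_proj r"
proof -
  interpret P: monoid P by fact
  obtain p' q' where p': "p' \<in> carrier P" "p \<otimes>\<^bsub>P\<^esub> p' = r" and q': "q' \<in> carrier P" "q \<otimes>\<^bsub>P\<^esub> q' = r"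
    using P.principal_self[OF pqr(3)] unfolding r[symmetric] by (auto simp: principal_mem_iff)
  note c = pqr p'(1) q'(1) rep_closed adj_closed
  have "range_proj p \<otimes> range_proj q = t p \<otimes> ((t p)\<^sup>\<star> \<otimes> t q) \<otimes> (t q)\<^sup>\<star>"
    using c by (simp add: range_proj_def mult_assoc)
  also have "(t p)\<^sup>\<star> \<otimes> t q = t p' \<otimes> (t q')\<^sup>\<star>"
    using covariant_lcm[OF pqr p'(1) q'(1) r p'(2) q'(2)] .
  also have "t p \<otimes> (t p' \<otimes> (t q')\<^sup>\<star>) \<otimes> (t q)\<^sup>\<star> = (t p \<otimes> t p') \<otimes> (t q \<otimes> t q')\<^sup>\<star>"
    using c by (simp add: mult_assoc adj_mult)
  finally show ?thesis
    using c p'(2) q'(2) by (simp add: rep_mult range_proj_def)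
qed

lemma range_proj_disjoint:
  assumes "p \<in> carrier P" "q \<in> carrier P"
    and "(p <#\<^bsub>P\<^esub> carrier P) \<inter> (q <#\<^bsub>P\<^esub> carrier P) = {}"
  shows "range_proj p \<otimes> range_proj q = \<zero>"
proof -
  have "range_proj p \<otimes> range_proj q = t p \<otimes> ((t p)\<^sup>\<star> \<otimes> t q) \<otimes> (t q)\<^sup>\<star>"
    using assms by (simp add: range_proj_def mult_assoc rep_closed adj_closed)
  then show ?thesis
    using assms by (simp add: covariant_disjoint rep_closed adj_closed)
qed

text \<open>The projection depends only on the ideal: apply the intersection law to \<open>pP \<inter> pP = qP\<close>.\<close>

lemma range_proj_cong:
  assumes "monoid P" "p \<in> carrier P" "q \<in> carrier P"
    and "p <#\<^bsub>P\<^esub> carrier P = q <#\<^bsub>P\<^esub> carrier P"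
  shows "range_proj p = range_proj q"
  using range_proj_inter[of p p q] range_proj_idem[of p] assms by simp

lemma range_proj_comm:
  assumes "right_lcm_semigroup P" "p \<in> carrier P" "q \<in> carrier P"
  shows "range_proj p \<otimes> range_proj q = range_proj q \<otimes> range_proj p"
proof (cases "(p <#\<^bsub>P\<^esub> carrier P) \<inter> (q <#\<^bsub>P\<^esub> carrier P) = {}")
  case True
  then show ?thesis
    using range_proj_disjoint[OF assms(2,3)] range_proj_disjoint[OF assms(3,2)]
    by (simp add: Int_commute)
next
  case False
  have P: "monoid P"
    using assms(1) by (simp add: right_lcm_semigroup_def left_cancellative_def)
  obtain r where "r \<in> carrier P"
      "(p <#\<^bsub>P\<^esub> carrier P) \<inter> (q <#\<^bsub>P\<^esub> carrier P) = r <#\<^bsub>P\<^esub> carrier P"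
    using right_lcm_semigroup_principal_inter[OF assms False] by blast
  then show ?thesis
    using range_proj_inter[OF P assms(2,3)] range_proj_inter[OF P assms(3,2)]
    by (metis Int_commute)
qed

end

lemma (in boundary_relations) e_principal:
  "p \<in> carrier P \<Longrightarrow> e (p <#\<^bsub>P\<^esub> carrier P) = v p \<otimes> (v p)\<^sup>\<star>"
  using e_translate[of p "carrier P"]
  by (simp add: constructible_ideals.whole e_whole rep_closed)

text \<open>Inserting the range projections gives \<open>v\<^sub>p\<^sup>* v\<^sub>q = v\<^sub>p\<^sup>* e\<^bsub>pP\<^esub> e\<^bsub>qP\<^esub> v\<^sub>q\<close>, and the product of the two
  projections is \<open>e\<^bsub>pP \<inter> qP\<^esub>\<close>, which is \<open>0\<close> or \<open>v\<^sub>p v\<^bsub>p'\<^esub> (v\<^sub>q v\<^bsub>q'\<^esub>)\<^sup>*\<close>.\<close>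

lemma (in boundary_relations) boundary_covariant:
  assumes P: "monoid P"
  shows "covariant_representation P B v"
proof
  interpret P: monoid P by fact
  have e: "(v p)\<^sup>\<star> \<otimes> v q = (v p)\<^sup>\<star> \<otimes> e ((p <#\<^bsub>P\<^esub> carrier P) \<inter> (q <#\<^bsub>P\<^esub> carrier P)) \<otimes> v q"
    if c: "p \<in> carrier P" "q \<in> carrier P" for p q
  proof -
    have "e ((p <#\<^bsub>P\<^esub> carrier P) \<inter> (q <#\<^bsub>P\<^esub> carrier P)) = v p \<otimes> (v p)\<^sup>\<star> \<otimes> (v q \<otimes> (v q)\<^sup>\<star>)"
      using c by (simp add: P.principal_constructible e_principal flip: e_inter)
    then show ?thesis
      using c by (simp add: mult_assoc rep_closed adj_closed rep_isometry rep_cancel)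
  qed
  show "(v p)\<^sup>\<star> \<otimes> v q = v p' \<otimes> (v q')\<^sup>\<star>"
    if c: "p \<in> carrier P" "q \<in> carrier P" "r \<in> carrier P" "p' \<in> carrier P" "q' \<in> carrier P"
      and r: "(p <#\<^bsub>P\<^esub> carrier P) \<inter> (q <#\<^bsub>P\<^esub> carrier P) = r <#\<^bsub>P\<^esub> carrier P"
        "p \<otimes>\<^bsub>P\<^esub> p' = r" "q \<otimes>\<^bsub>P\<^esub> q' = r"
    for p q r p' q'
  proof -
    have "e (r <#\<^bsub>P\<^esub> carrier P) = (v p \<otimes> v p') \<otimes> (v q \<otimes> v q')\<^sup>\<star>"
      using c r(2,3) by (simp add: e_principal rep_mult)
    then show ?thesis
      using e[OF c(1,2)] c
      by (simp add: r(1) mult_assoc rep_closed adj_closed adj_mult rep_isometry rep_cancel)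
  qed
  show "(v p)\<^sup>\<star> \<otimes> v q = \<zero>"
    if c: "p \<in> carrier P" "q \<in> carrier P"
      and "(p <#\<^bsub>P\<^esub> carrier P) \<inter> (q <#\<^bsub>P\<^esub> carrier P) = {}" for p q
    using e[OF c] that by (simp add: e_empty rep_closed adj_closed)
qed

section \<open>Ideal structure of the Zappa--Szep product\<close>

lemma carrier_zappa_szep: "carrier (zappa_szep U A act res) = carrier U \<times> carrier A"
  by (simp add: zappa_szep_def)

lemma zappa_szep_simps [simp]:
  "x \<in> carrier (zappa_szep U A act res) \<longleftrightarrow> fst x \<in> carrier U \<and> snd x \<in> carrier A"
  "(u, a) \<otimes>\<^bsub>zappa_szep U A act res\<^esub> (v, b) = (u \<otimes>\<^bsub>U\<^esub> act a v, res a v \<otimes>\<^bsub>A\<^esub> b)"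
  "\<one>\<^bsub>zappa_szep U A act res\<^esub> = (\<one>\<^bsub>U\<^esub>, \<one>\<^bsub>A\<^esub>)"
  by (simp_all add: zappa_szep_def mem_Times_iff)

text \<open>Principal right ideals belong to \<open>\<J>(A)\<close>, so the chain condition below is the form in which
  the total order of \<open>\<J>(A)\<close> is applied.\<close>

locale right_lcm_zappa_szep = zappa_szep_pair U A act res
  for U :: "'u monoid" and A :: "'a monoid"
    and act :: "'a \<Rightarrow> 'u \<Rightarrow> 'u" and res :: "'a \<Rightarrow> 'u \<Rightarrow> 'a" +
  assumes U_right_lcm: "right_lcm_semigroup U"
    and A_left_cancellative: "left_cancellative A"
    and A_principal_chain: "\<lbrakk>a \<in> carrier A; b \<in> carrier A\<rbrakk>
      \<Longrightarrow> a <#\<^bsub>A\<^esub> carrier A \<subseteq> b <#\<^bsub>A\<^esub> carrier A \<or> b <#\<^bsub>A\<^esub> carrier A \<subseteq> a <#\<^bsub>A\<^esub> carrier A"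
    and act_bij: "a \<in> carrier A \<Longrightarrow> bij_betw (act a) (carrier U) (carrier U)"
begin

abbreviation P where "P \<equiv> zappa_szep U A act res"

declare act_closed [simp, intro] res_closed [simp, intro] B1 [simp] B3 [simp] B4 [simp] B7 [simp]

lemma U_left_cancellative: "left_cancellative U"
  using U_right_lcm by (simp add: right_lcm_semigroup_def)

lemma act_inj:
  "\<lbrakk>act a u = act a v; a \<in> carrier A; u \<in> carrier U; v \<in> carrier U\<rbrakk> \<Longrightarrow> u = v"
  using act_bij[of a] unfolding bij_betw_def inj_on_def by blast

lemma act_surj:
  assumes "a \<in> carrier A" "u \<in> carrier U"
  obtains z where "z \<in> carrier U" "act a z = u"
  using act_bij[OF assms(1)] assms(2) unfolding bij_betw_def by (metis imageE)

lemma P_monoid: "monoid P"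
proof
  fix x y z
  assume xyz: "x \<in> carrier P" "y \<in> carrier P" "z \<in> carrier P"
  show "x \<otimes>\<^bsub>P\<^esub> y \<otimes>\<^bsub>P\<^esub> z = x \<otimes>\<^bsub>P\<^esub> (y \<otimes>\<^bsub>P\<^esub> z)"
    using xyz by (cases x; cases y; cases z) (simp add: B2 B5 B6 B8 U.m_assoc A.m_assoc)
qed (auto)

sublocale P: monoid P
  by (rule P_monoid)

lemma P_left_cancellative: "left_cancellative P"
  unfolding left_cancellative_def
proof (intro conjI ballI impI)
  show "monoid P" by (rule P_monoid)
  fix p q r
  assume "p \<in> carrier P" "q \<in> carrier P" "r \<in> carrier P" and eq: "p \<otimes>\<^bsub>P\<^esub> q = p \<otimes>\<^bsub>P\<^esub> r"
  then obtain u a v b w c where p: "p = (u, a)" "u \<in> carrier U" "a \<in> carrier A"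
    and q: "q = (v, b)" "v \<in> carrier U" "b \<in> carrier A"
    and r: "r = (w, c)" "w \<in> carrier U" "c \<in> carrier A"
    by (auto simp: carrier_zappa_szep)
  have "act a v = act a w"
    using left_cancellativeD[OF U_left_cancellative, of u] eq p q r by auto
  then have "v = w"
    using act_inj p q r by blast
  moreover from this have "b = c"
    using left_cancellativeD[OF A_left_cancellative, of "res a v"] eq p q r by auto
  ultimately show "q = r" by (simp add: q r)
qed

lemma P_principal_mem_iff:
  "x \<in> (u, a) <#\<^bsub>P\<^esub> carrier P \<longleftrightarrow>
     (\<exists>z\<in>carrier U. \<exists>d\<in>carrier A. x = (u \<otimes>\<^bsub>U\<^esub> act a z, res a z \<otimes>\<^bsub>A\<^esub> d))"
  unfolding principal_mem_iff by (auto simp: carrier_zappa_szep)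

lemma fst_P_principal:
  assumes "u \<in> carrier U" "a \<in> carrier A"
  shows "fst ` ((u, a) <#\<^bsub>P\<^esub> carrier P) = u <#\<^bsub>U\<^esub> carrier U"
proof
  show "fst ` ((u, a) <#\<^bsub>P\<^esub> carrier P) \<subseteq> u <#\<^bsub>U\<^esub> carrier U"
  proof
    fix x assume "x \<in> fst ` ((u, a) <#\<^bsub>P\<^esub> carrier P)"
    then obtain z where "z \<in> carrier U" "x = u \<otimes>\<^bsub>U\<^esub> act a z"
      unfolding image_iff Bex_def P_principal_mem_iff by auto
    then show "x \<in> u <#\<^bsub>U\<^esub> carrier U"
      unfolding principal_mem_iff using assms act_closed by blast
  qed
  show "u <#\<^bsub>U\<^esub> carrier U \<subseteq> fst ` ((u, a) <#\<^bsub>P\<^esub> carrier P)"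
  proof
    fix x assume "x \<in> u <#\<^bsub>U\<^esub> carrier U"
    then obtain k where k: "k \<in> carrier U" "x = u \<otimes>\<^bsub>U\<^esub> k"
      by (auto simp: principal_mem_iff)
    obtain z where "z \<in> carrier U" "act a z = k"
      using act_surj[OF assms(2) k(1)] .
    then have "(x, res a z \<otimes>\<^bsub>A\<^esub> \<one>\<^bsub>A\<^esub>) \<in> (u, a) <#\<^bsub>P\<^esub> carrier P"
      unfolding P_principal_mem_iff using k(2) A.one_closed by blast
    then show "x \<in> fst ` ((u, a) <#\<^bsub>P\<^esub> carrier P)" by force
  qed
qed

text \<open>The part of \<open>(u, a)P\<close> over \<open>wU\<close>, where \<open>w = u (a \<cdot> z)\<close>, is \<open>(u, a)(z, 1)P\<close>. For an element
  \<open>(u (a \<cdot> y), _)\<close> with \<open>u (a \<cdot> y) = w k\<close>, write \<open>k = a|\<^sub>z \<cdot> l\<close>; then \<open>u (a \<cdot> y) = u (a \<cdot> (z l))\<close> by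
  (B5), and cancellation in \<open>U\<close> together with injectivity of \<open>a\<close> gives \<open>y = z l\<close>.\<close>

lemma P_principal_restrict:
  assumes u: "u \<in> carrier U" and a: "a \<in> carrier A" and z: "z \<in> carrier U"
    and w: "w = u \<otimes>\<^bsub>U\<^esub> act a z"
  shows "{x \<in> (u, a) <#\<^bsub>P\<^esub> carrier P. fst x \<in> w <#\<^bsub>U\<^esub> carrier U}
    = (w, res a z) <#\<^bsub>P\<^esub> carrier P" (is "?L = ?R")
proof
  have w': "w \<in> carrier U" using assms by simp
  have r: "res a z \<in> carrier A" using a z by simp
  have "?R = ((u, a) \<otimes>\<^bsub>P\<^esub> (z, \<one>\<^bsub>A\<^esub>)) <#\<^bsub>P\<^esub> carrier P"
    using assms by simp
  then have "?R \<subseteq> (u, a) <#\<^bsub>P\<^esub> carrier P"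
    using P.principal_mult_subset[of "(u, a)" "(z, \<one>\<^bsub>A\<^esub>)"] u a z by simp
  then show "?R \<subseteq> ?L"
    using fst_P_principal[OF w' r] by blast
  show "?L \<subseteq> ?R"
  proof
    fix x assume "x \<in> ?L"
    then obtain y d k where y: "y \<in> carrier U" "d \<in> carrier A" "k \<in> carrier U"
        "x = (u \<otimes>\<^bsub>U\<^esub> act a y, res a y \<otimes>\<^bsub>A\<^esub> d)" "u \<otimes>\<^bsub>U\<^esub> act a y = w \<otimes>\<^bsub>U\<^esub> k"
      unfolding P_principal_mem_iff principal_mem_iff by auto
    obtain l where l: "l \<in> carrier U" "act (res a z) l = k"
      using act_surj[OF r y(3)] .
    have "u \<otimes>\<^bsub>U\<^esub> act a y = u \<otimes>\<^bsub>U\<^esub> act a (z \<otimes>\<^bsub>U\<^esub> l)"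
      using assms l y by (simp add: B5 U.m_assoc)
    then have "act a y = act a (z \<otimes>\<^bsub>U\<^esub> l)"
      using left_cancellativeD[OF U_left_cancellative _ u] a y z l by blast
    then have "y = z \<otimes>\<^bsub>U\<^esub> l"
      using act_inj[OF _ a y(1)] z l by blast
    then have "x = (w \<otimes>\<^bsub>U\<^esub> act (res a z) l, res (res a z) l \<otimes>\<^bsub>A\<^esub> d)"
      using y l a z by (simp add: B6)
    then show "x \<in> ?R"
      unfolding P_principal_mem_iff using l(1) y(2) by blast
  qed
qed

lemma P_principal_inter_restrict:
  assumes uv: "u \<in> carrier U" "v \<in> carrier U" and ab: "a \<in> carrier A" "b \<in> carrier A"
    and yz: "z \<in> carrier U" "y \<in> carrier U"
    and w: "w = u \<otimes>\<^bsub>U\<^esub> act a z" "w = v \<otimes>\<^bsub>U\<^esub> act b y"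
    and lcm: "(u <#\<^bsub>U\<^esub> carrier U) \<inter> (v <#\<^bsub>U\<^esub> carrier U) = w <#\<^bsub>U\<^esub> carrier U"
  shows "((u, a) <#\<^bsub>P\<^esub> carrier P) \<inter> ((v, b) <#\<^bsub>P\<^esub> carrier P)
    = ((w, res a z) <#\<^bsub>P\<^esub> carrier P) \<inter> ((w, res b y) <#\<^bsub>P\<^esub> carrier P)"
proof -
  let ?X = "(u, a) <#\<^bsub>P\<^esub> carrier P" and ?Y = "(v, b) <#\<^bsub>P\<^esub> carrier P"
  have "fst x \<in> w <#\<^bsub>U\<^esub> carrier U" if x: "x \<in> ?X \<inter> ?Y" for x
  proof -
    have "fst x \<in> fst ` ?X" "fst x \<in> fst ` ?Y"
      using x by simp_all
    then show ?thesis
      unfolding fst_P_principal[OF uv(1) ab(1)] fst_P_principal[OF uv(2) ab(2)]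
      unfolding lcm[symmetric] by (rule IntI)
  qed
  then have "?X \<inter> ?Y = {x \<in> ?X. fst x \<in> w <#\<^bsub>U\<^esub> carrier U}
      \<inter> {x \<in> ?Y. fst x \<in> w <#\<^bsub>U\<^esub> carrier U}"
    by blast
  then show ?thesis
    unfolding P_principal_restrict[OF uv(1) ab(1) yz(1) w(1)]
      P_principal_restrict[OF uv(2) ab(2) yz(2) w(2)] .
qed

lemma P_principal_mono:
  assumes "w \<in> carrier U" "a \<in> carrier A" "b \<in> carrier A"
    and "a <#\<^bsub>A\<^esub> carrier A \<subseteq> b <#\<^bsub>A\<^esub> carrier A"
  shows "(w, a) <#\<^bsub>P\<^esub> carrier P \<subseteq> (w, b) <#\<^bsub>P\<^esub> carrier P"
proof -
  obtain c where "c \<in> carrier A" "a = b \<otimes>\<^bsub>A\<^esub> c"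
    using subsetD[OF assms(4) A.principal_self[OF assms(2)]] unfolding principal_mem_iff by blast
  then show ?thesis
    using P.principal_mult_subset[of "(w, b)" "(\<one>\<^bsub>U\<^esub>, c)"] assms by simp
qed

text \<open>Both ideals are cut down to ideals over the same \<open>wU\<close>, and these are nested because the
  principal right ideals of \<open>A\<close> are.\<close>

lemma P_principal_inter:
  assumes uv: "u \<in> carrier U" "v \<in> carrier U" and ab: "a \<in> carrier A" "b \<in> carrier A"
    and w: "w \<in> carrier U"
    and lcm: "(u <#\<^bsub>U\<^esub> carrier U) \<inter> (v <#\<^bsub>U\<^esub> carrier U) = w <#\<^bsub>U\<^esub> carrier U"
  shows "\<exists>c\<in>carrier A. ((u, a) <#\<^bsub>P\<^esub> carrier P) \<inter> ((v, b) <#\<^bsub>P\<^esub> carrier P)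
    = (w, c) <#\<^bsub>P\<^esub> carrier P"
proof -
  obtain u' v' where u': "u' \<in> carrier U" "w = u \<otimes>\<^bsub>U\<^esub> u'" and v': "v' \<in> carrier U" "w = v \<otimes>\<^bsub>U\<^esub> v'"
    using U.principal_self[OF w] unfolding lcm[symmetric] by (auto simp: principal_mem_iff)
  obtain z where z: "z \<in> carrier U" "act a z = u'" using act_surj[OF ab(1) u'(1)] .
  obtain y where y: "y \<in> carrier U" "act b y = v'" using act_surj[OF ab(2) v'(1)] .
  have c: "res a z \<in> carrier A" "res b y \<in> carrier A"
    using ab z y by simp_all
  have inter: "((u, a) <#\<^bsub>P\<^esub> carrier P) \<inter> ((v, b) <#\<^bsub>P\<^esub> carrier P)
      = ((w, res a z) <#\<^bsub>P\<^esub> carrier P) \<inter> ((w, res b y) <#\<^bsub>P\<^esub> carrier P)"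
    using P_principal_inter_restrict[OF uv ab z(1) y(1) _ _ lcm] u' v' z y by simp
  from A_principal_chain[OF c] show ?thesis
  proof
    assume "res a z <#\<^bsub>A\<^esub> carrier A \<subseteq> res b y <#\<^bsub>A\<^esub> carrier A"
    from P_principal_mono[OF w c this] show ?thesis
      unfolding inter by (intro bexI[OF _ c(1)]) (rule Int_absorb2)
  next
    assume "res b y <#\<^bsub>A\<^esub> carrier A \<subseteq> res a z <#\<^bsub>A\<^esub> carrier A"
    from P_principal_mono[OF w c(2,1) this] show ?thesis
      unfolding inter by (intro bexI[OF _ c(2)]) (rule Int_absorb1)
  qed
qed

text \<open>For the elements \<open>(u, 1)\<close> the restrictions of the second components are trivial, so the
  second component of the least common multiple is \<open>1\<close> as well. This makes \<open>u \<mapsto> v (u, 1)\<close>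
  covariant whenever \<open>v\<close> is.\<close>

lemma P_principal_inter_unit:
  assumes "u \<in> carrier U" "v \<in> carrier U" and w: "w \<in> carrier U"
    and lcm: "(u <#\<^bsub>U\<^esub> carrier U) \<inter> (v <#\<^bsub>U\<^esub> carrier U) = w <#\<^bsub>U\<^esub> carrier U"
  shows "((u, \<one>\<^bsub>A\<^esub>) <#\<^bsub>P\<^esub> carrier P) \<inter> ((v, \<one>\<^bsub>A\<^esub>) <#\<^bsub>P\<^esub> carrier P)
    = (w, \<one>\<^bsub>A\<^esub>) <#\<^bsub>P\<^esub> carrier P"
proof -
  obtain z y where "z \<in> carrier U" "w = u \<otimes>\<^bsub>U\<^esub> z" "y \<in> carrier U" "w = v \<otimes>\<^bsub>U\<^esub> y"
    using U.principal_self[OF w] unfolding lcm[symmetric] by (auto simp: principal_mem_iff)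
  then have "((u, \<one>\<^bsub>A\<^esub>) <#\<^bsub>P\<^esub> carrier P) \<inter> ((v, \<one>\<^bsub>A\<^esub>) <#\<^bsub>P\<^esub> carrier P)
      = ((w, res \<one>\<^bsub>A\<^esub> z) <#\<^bsub>P\<^esub> carrier P) \<inter> ((w, res \<one>\<^bsub>A\<^esub> y) <#\<^bsub>P\<^esub> carrier P)"
    using lcm by (intro P_principal_inter_restrict assms A.one_closed) (simp_all only: B1)
  then show ?thesis
    using \<open>z \<in> carrier U\<close> \<open>y \<in> carrier U\<close> by (simp only: B7 Int_absorb)
qed

lemma P_principal_disjoint_iff:
  assumes "u \<in> carrier U" "v \<in> carrier U" "a \<in> carrier A" "b \<in> carrier A"
  shows "((u, a) <#\<^bsub>P\<^esub> carrier P) \<inter> ((v, b) <#\<^bsub>P\<^esub> carrier P) = {}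
    \<longleftrightarrow> (u <#\<^bsub>U\<^esub> carrier U) \<inter> (v <#\<^bsub>U\<^esub> carrier U) = {}" (is "?L \<longleftrightarrow> ?R")
proof
  assume ?R
  then show ?L
    using fst_P_principal[OF assms(1,3)] fst_P_principal[OF assms(2,4)] by blast
next
  assume L: ?L
  show ?R
  proof (rule ccontr)
    assume "\<not> ?R"
    then obtain w where w: "w \<in> carrier U"
        "(u <#\<^bsub>U\<^esub> carrier U) \<inter> (v <#\<^bsub>U\<^esub> carrier U) = w <#\<^bsub>U\<^esub> carrier U"
      using right_lcm_semigroup_principal_inter[OF U_right_lcm assms(1,2)] by blast
    obtain c where c: "c \<in> carrier A"
        "((u, a) <#\<^bsub>P\<^esub> carrier P) \<inter> ((v, b) <#\<^bsub>P\<^esub> carrier P) = (w, c) <#\<^bsub>P\<^esub> carrier P"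
      using P_principal_inter[OF assms w] by blast
    have "(w, c) \<in> (w, c) <#\<^bsub>P\<^esub> carrier P"
      using P.principal_self[of "(w, c)"] w(1) c(1) by simp
    then show False
      using L c(2) by simp
  qed
qed

lemma P_constructible_cases:
  assumes "X \<in> constructible_ideals P"
  obtains "X = {}" | u a where "u \<in> carrier U" "a \<in> carrier A" "X = (u, a) <#\<^bsub>P\<^esub> carrier P"
proof (cases "X = {}")
  case False
  have "\<exists>r\<in>carrier P. (p <#\<^bsub>P\<^esub> carrier P) \<inter> (q <#\<^bsub>P\<^esub> carrier P) = r <#\<^bsub>P\<^esub> carrier P"
    if pq: "p \<in> carrier P" "q \<in> carrier P"
      and ne: "(p <#\<^bsub>P\<^esub> carrier P) \<inter> (q <#\<^bsub>P\<^esub> carrier P) \<noteq> {}" for p q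
  proof -
    obtain u a v b where p: "p = (u, a)" "u \<in> carrier U" "a \<in> carrier A"
      and q: "q = (v, b)" "v \<in> carrier U" "b \<in> carrier A"
      using pq by (auto simp: carrier_zappa_szep)
    have "(u <#\<^bsub>U\<^esub> carrier U) \<inter> (v <#\<^bsub>U\<^esub> carrier U) \<noteq> {}"
      using P_principal_disjoint_iff[OF p(2) q(2) p(3) q(3)] ne p(1) q(1) by simp
    then obtain w where w: "w \<in> carrier U"
        "(u <#\<^bsub>U\<^esub> carrier U) \<inter> (v <#\<^bsub>U\<^esub> carrier U) = w <#\<^bsub>U\<^esub> carrier U"
      using right_lcm_semigroup_principal_inter[OF U_right_lcm p(2) q(2)] by blast
    obtain c where "c \<in> carrier A"
        "((u, a) <#\<^bsub>P\<^esub> carrier P) \<inter> ((v, b) <#\<^bsub>P\<^esub> carrier P) = (w, c) <#\<^bsub>P\<^esub> carrier P"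
      using P_principal_inter[OF p(2) q(2) p(3) q(3) w] by blast
    then show ?thesis
      using w(1) p(1) q(1) by auto
  qed
  then have "\<exists>p\<in>carrier P. X = p <#\<^bsub>P\<^esub> carrier P"
    using constructible_ideals_principal[OF P_left_cancellative _ assms False] by blast
  then show thesis using that(2) by (auto simp: carrier_zappa_szep)
qed (rule that(1))

text \<open>Being disjoint is decided by the first components, so the foundation property is, too.\<close>

lemma foundation_set_fst_iff:
  assumes "F \<subseteq> carrier P" "finite F"
  shows "foundation_set P F \<longleftrightarrow> foundation_set U (fst ` F)"
proof -
  have iff: "((w, c) <#\<^bsub>P\<^esub> carrier P) \<inter> (q <#\<^bsub>P\<^esub> carrier P) \<noteq> {}
      \<longleftrightarrow> (w <#\<^bsub>U\<^esub> carrier U) \<inter> (fst q <#\<^bsub>U\<^esub> carrier U) \<noteq> {}"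
    if "q \<in> F" "w \<in> carrier U" "c \<in> carrier A" for q w c
  proof -
    have "fst q \<in> carrier U" "snd q \<in> carrier A"
      using subsetD[OF assms(1) that(1)] by auto
    then show ?thesis
      using P_principal_disjoint_iff[of w "fst q" c "snd q"] that(2,3)
      by simp
  qed
  have "foundation_set P F \<longleftrightarrow> (\<forall>w\<in>carrier U. \<forall>c\<in>carrier A. \<exists>q\<in>F.
      ((w, c) <#\<^bsub>P\<^esub> carrier P) \<inter> (q <#\<^bsub>P\<^esub> carrier P) \<noteq> {})"
    using assms unfolding foundation_set_def by (simp add: carrier_zappa_szep)
  also have "\<dots> \<longleftrightarrow> (\<forall>w\<in>carrier U. \<forall>c\<in>carrier A. \<exists>q\<in>F.
      (w <#\<^bsub>U\<^esub> carrier U) \<inter> (fst q <#\<^bsub>U\<^esub> carrier U) \<noteq> {})"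
    by (intro ball_cong bex_cong refl iff)
  also have "\<dots> \<longleftrightarrow> foundation_set U (fst ` F)"
    using assms A.one_closed unfolding foundation_set_def by auto
  finally show ?thesis .
qed

section \<open>Matching families\<close>

lemma boundary_imp_zappa_szep_relations:
  fixes B :: "'b cstar" (structure)
  assumes "boundary_relations P B v e"
  shows "zappa_szep_relations U A act res B (\<lambda>a. v (\<one>\<^bsub>U\<^esub>, a)) (\<lambda>u. v (u, \<one>\<^bsub>A\<^esub>))"
    and "\<lbrakk>u \<in> carrier U; a \<in> carrier A\<rbrakk> \<Longrightarrow> v (u, a) = v (u, \<one>\<^bsub>A\<^esub>) \<otimes> v (\<one>\<^bsub>U\<^esub>, a)"
proof -
  interpret boundary_relations P B v e by fact
  interpret c: covariant_representation P B v
    by (rule boundary_covariant[OF P_monoid])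
  let ?s = "\<lambda>a. v (\<one>\<^bsub>U\<^esub>, a)" and ?t = "\<lambda>u. v (u, \<one>\<^bsub>A\<^esub>)"
  interpret s: isometric_representation A B ?s
    by unfold_locales (simp_all add: rep_closed rep_isometry rep_mult)
  interpret t: covariant_representation U B ?t
  proof unfold_locales
    fix p q r p' q'
    assume pq: "p \<in> carrier U" "q \<in> carrier U"
    show "?t p \<in> carrier B" "(?t p)\<^sup>\<star> \<otimes> ?t p = \<one>" "?t p \<otimes> ?t q = ?t (p \<otimes>\<^bsub>U\<^esub> q)"
      using pq by (simp_all add: rep_closed rep_isometry rep_mult)
    show "(?t p)\<^sup>\<star> \<otimes> ?t q = \<zero>"
      if "(p <#\<^bsub>U\<^esub> carrier U) \<inter> (q <#\<^bsub>U\<^esub> carrier U) = {}"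
      using P_principal_disjoint_iff[OF pq A.one_closed A.one_closed] that pq
        c.covariant_disjoint[of "(p, \<one>\<^bsub>A\<^esub>)" "(q, \<one>\<^bsub>A\<^esub>)"] by simp
    show "(?t p)\<^sup>\<star> \<otimes> ?t q = ?t p' \<otimes> (?t q')\<^sup>\<star>"
      if "r \<in> carrier U" "p' \<in> carrier U" "q' \<in> carrier U"
        "(p <#\<^bsub>U\<^esub> carrier U) \<inter> (q <#\<^bsub>U\<^esub> carrier U) = r <#\<^bsub>U\<^esub> carrier U"
        "p \<otimes>\<^bsub>U\<^esub> p' = r" "q \<otimes>\<^bsub>U\<^esub> q' = r"
      by (rule c.covariant_lcm[OF _ _ _ _ _ P_principal_inter_unit[OF pq that(1,4)]])
        (use pq that in simp_all)
  qed
  show split: "v (u, a) = ?t u \<otimes> ?s a" if "u \<in> carrier U" "a \<in> carrier A" for u a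
    using that by (simp add: rep_mult)
  have K1: "?s a \<otimes> ?t u = ?t (act a u) \<otimes> ?s (res a u)"
    if "a \<in> carrier A" "u \<in> carrier U" for a u
    using that by (simp add: rep_mult)
  have Q1: "?s a \<otimes> (?s a)\<^sup>\<star> = \<one>" if a: "a \<in> carrier A" for a
  proof -
    \<comment> \<open>Every nonempty subset of \<open>U\<close> meets \<open>1U = U\<close>, hence \<open>{(1, a)}\<close> is a foundation set.\<close>
    have "{(\<one>\<^bsub>U\<^esub>, a)} \<subseteq> carrier P"
      using a by simp
    moreover have "foundation_set U {\<one>\<^bsub>U\<^esub>}"
      unfolding foundation_set_def
      using U.principal_self by (auto simp: l_coset_def)
    ultimately have "foundation_set P {(\<one>\<^bsub>U\<^esub>, a)}"
      using foundation_set_fst_iff[of "{(\<one>\<^bsub>U\<^esub>, a)}"] by simp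
    from e_foundation[OF this, of "[(\<one>\<^bsub>U\<^esub>, a)]"]
    have "(\<one> \<ominus> ?s a \<otimes> (?s a)\<^sup>\<star>) \<otimes> \<one> = \<zero>"
      using a by (simp add: defect_product_def e_principal)
    then show ?thesis
      using a ring.r_right_minus_eq[OF B_ring] by (simp add: rep_closed adj_closed)
  qed
  show "zappa_szep_relations U A act res B ?s ?t"
  proof unfold_locales
    show "?s a \<otimes> ?t u = ?t (act a u) \<otimes> ?s (res a u)"
      if "a \<in> carrier A" "u \<in> carrier U" for a u
      by (rule K1[OF that])
    show "?s a \<otimes> (?s a)\<^sup>\<star> = \<one>" if "a \<in> carrier A" for a
      by (rule Q1[OF that])
    show "(?s a)\<^sup>\<star> \<otimes> ?t u = ?t z \<otimes> (?s (res a z))\<^sup>\<star>"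
      if c: "a \<in> carrier A" "u \<in> carrier U" "z \<in> carrier U" and u: "act a z = u" for a u z
    proof -
      \<comment> \<open>(K2) is (K1) at \<open>z\<close> multiplied by \<open>s\<^sub>a\<^sup>*\<close> on the left and, as \<open>s\<^bsub>a|z\<^esub>\<close> is unitary by
        (Q1), by its adjoint on the right.\<close>
      note closed = c res_closed s.rep_closed t.rep_closed adj_closed
      have "?t z \<otimes> (?s (res a z))\<^sup>\<star> = (?s a)\<^sup>\<star> \<otimes> (?s a \<otimes> ?t z) \<otimes> (?s (res a z))\<^sup>\<star>"
        using closed by (simp add: s.rep_cancel)
      also have "\<dots> = (?s a)\<^sup>\<star> \<otimes> (?t u \<otimes> (?s (res a z) \<otimes> (?s (res a z))\<^sup>\<star>))"
        using closed K1[of a z] by (simp add: u mult_assoc)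
      also have "\<dots> = (?s a)\<^sup>\<star> \<otimes> ?t u"
        using closed by (simp add: Q1)
      finally show ?thesis ..
    qed
    show "defect_product B (\<lambda>u. ?t u \<otimes> (?t u)\<^sup>\<star>) us = \<zero>"
      if F: "foundation_set U F" "set us = F" "distinct us" for F us
    proof -
      let ?i = "\<lambda>u. (u, \<one>\<^bsub>A\<^esub>)"
      have c: "F \<subseteq> carrier U" "finite F"
        using F(1) by (simp_all add: foundation_set_def)
      then have "?i ` F \<subseteq> carrier P"
        by auto
      then have "foundation_set P (?i ` F)"
        using foundation_set_fst_iff[of "?i ` F"] F(1) c(2) by (simp add: image_image)
      then have "defect_product B (\<lambda>p. e (p <#\<^bsub>P\<^esub> carrier P)) (map ?i us) = \<zero>"
        by (rule e_foundation) (use F in \<open>simp_all add: distinct_map inj_on_def\<close>)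
      moreover have "defect_product B (\<lambda>u. e (?i u <#\<^bsub>P\<^esub> carrier P)) us
          = defect_product B (\<lambda>u. ?t u \<otimes> (?t u)\<^sup>\<star>) us"
        using F(2) c(1) by (intro defect_product_cong e_principal) auto
      ultimately show ?thesis
        by (simp only: defect_product_map)
    qed
  qed
qed

text \<open>The projection \<open>e X\<close> is defined through the image of \<open>X\<close> in \<open>U\<close>: by (Q1) the factor
  \<open>s\<^sub>a s\<^sub>a\<^sup>*\<close> disappears from the range projection of \<open>t\<^sub>u s\<^sub>a\<close>, and \<open>t\<^sub>u t\<^sub>u\<^sup>*\<close> depends only on \<open>uU\<close>.\<close>

lemma zappa_szep_relations_imp_boundary:
  fixes B :: "'b cstar" (structure)
  assumes "zappa_szep_relations U A act res B s t"
  shows "\<exists>v e. boundary_relations P B v e \<and>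
    (\<forall>u\<in>carrier U. \<forall>a\<in>carrier A. v (u, a) = t u \<otimes> s a)"
proof -
  interpret zappa_szep_relations U A act res B s t by fact
  define v where "v = (\<lambda>(u, a). t u \<otimes> s a)"
  define e where "e X = (if X = {} then \<zero>
    else t.range_proj (SOME u. u \<in> carrier U \<and> fst ` X = u <#\<^bsub>U\<^esub> carrier U))" for X :: "('u \<times> 'a) set"
  note closed = s.rep_closed t.rep_closed s.adj_closed
  have e_P: "e ((u, a) <#\<^bsub>P\<^esub> carrier P) = t.range_proj u"
    if u: "u \<in> carrier U" and a: "a \<in> carrier A" for u a
  proof -
    let ?w = "SOME w. w \<in> carrier U \<and> u <#\<^bsub>U\<^esub> carrier U = w <#\<^bsub>U\<^esub> carrier U"
    have "?w \<in> carrier U \<and> u <#\<^bsub>U\<^esub> carrier U = ?w <#\<^bsub>U\<^esub> carrier U"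
      by (rule someI[of _ u]) (simp add: u)
    then have "t.range_proj u = t.range_proj ?w"
      by (intro t.range_proj_cong[OF U.monoid_axioms u]) simp_all
    moreover have "(u, a) \<in> (u, a) <#\<^bsub>P\<^esub> carrier P"
      using P.principal_self[of "(u, a)"] u a by simp
    ultimately show ?thesis
      unfolding e_def fst_P_principal[OF u a] by (simp only: empty_iff if_False split: if_split) auto
  qed
  have e_empty: "e {} = \<zero>"
    by (simp add: e_def)
  \<comment> \<open>Conjugation by \<open>s\<^sub>c\<close> realises the action on range projections; this is what makes \<open>e\<close>
    compatible with left translation by \<open>(w, c)\<close>.\<close>
  have conj_s: "s c \<otimes> t.range_proj u \<otimes> (s c)\<^sup>\<star> = t.range_proj (act c u)"
    if c: "c \<in> carrier A" "u \<in> carrier U" for c u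
  proof -
    have "s c \<otimes> t.range_proj u \<otimes> (s c)\<^sup>\<star> = (s c \<otimes> t u) \<otimes> (s c \<otimes> t u)\<^sup>\<star>"
      using c by (simp add: t.range_proj_def closed s.adj_mult s.mult_assoc)
    also have "\<dots> = t (act c u) \<otimes> ((s (res c u) \<otimes> (s (res c u))\<^sup>\<star>) \<otimes> (t (act c u))\<^sup>\<star>)"
      unfolding K1[OF c] using c by (simp add: closed s.adj_mult s.mult_assoc)
    also have "\<dots> = t.range_proj (act c u)"
      using c by (simp add: Q1 closed t.range_proj_def)
    finally show ?thesis .
  qed
  have e_closed: "e X \<in> carrier B" if "X \<in> constructible_ideals P" for X
    by (rule P_constructible_cases[OF that]) (simp_all add: e_P e_empty t.range_proj_closed)
  have "boundary_relations P B v e"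
  proof unfold_locales
    fix p q
    assume pq: "p \<in> carrier P" "q \<in> carrier P"
    obtain u a w b where p: "p = (u, a)" "u \<in> carrier U" "a \<in> carrier A"
      and q: "q = (w, b)" "w \<in> carrier U" "b \<in> carrier A"
      using pq by (auto simp: carrier_zappa_szep)
    show "v p \<in> carrier B"
      using p by (simp add: v_def closed)
    show "(v p)\<^sup>\<star> \<otimes> v p = \<one>"
      using p by (simp add: v_def closed s.adj_mult s.mult_assoc t.rep_cancel s.rep_isometry)
    have "v p \<otimes> v q = t u \<otimes> ((s a \<otimes> t w) \<otimes> s b)"
      using p q by (simp add: v_def closed s.mult_assoc)
    also have "\<dots> = (t u \<otimes> t (act a w)) \<otimes> (s (res a w) \<otimes> s b)"
      unfolding K1[OF p(3) q(2)] using p q by (simp add: closed s.mult_assoc)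
    also have "\<dots> = v (p \<otimes>\<^bsub>P\<^esub> q)"
      using p q by (simp add: s.rep_mult t.rep_mult v_def)
    finally show "v p \<otimes> v q = v (p \<otimes>\<^bsub>P\<^esub> q)" .
  next
    show "e (carrier P) = \<one>"
    proof -
      have "carrier P = \<one>\<^bsub>P\<^esub> <#\<^bsub>P\<^esub> carrier P"
        using P.l_one by (force simp: l_coset_def)
      then have "e (carrier P) = t.range_proj \<one>\<^bsub>U\<^esub>"
        using e_P[of "\<one>\<^bsub>U\<^esub>" "\<one>\<^bsub>A\<^esub>"] by simp
      then show ?thesis
        using t.rep_isometry[of "\<one>\<^bsub>U\<^esub>"] t.rep_one[OF U.monoid_axioms]
        by (simp add: t.range_proj_def s.adj_closed)
    qed
    show "e {} = \<zero>"
      by (rule e_empty)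
  next
    fix X assume X: "X \<in> constructible_ideals P"
    show "e X \<in> carrier B"
      by (rule e_closed[OF X])
    show "e X \<otimes> e X = e X" "(e X)\<^sup>\<star> = e X"
      by (rule P_constructible_cases[OF X];
          simp add: e_P e_empty t.range_proj_idem t.range_proj_adj s.adj_zero)+
    show "v p \<otimes> e X \<otimes> (v p)\<^sup>\<star> = e (p <#\<^bsub>P\<^esub> X)" if p: "p \<in> carrier P" for p
    proof -
      obtain w c where wc: "p = (w, c)" "w \<in> carrier U" "c \<in> carrier A"
        using p by (auto simp: carrier_zappa_szep)
      show ?thesis
      proof (rule P_constructible_cases[OF X])
        assume "X = {}"
        then show ?thesis
          using wc by (simp add: e_empty v_def closed l_coset_def)
      next
        fix u a
        assume u: "u \<in> carrier U" and a: "a \<in> carrier A" and X: "X = (u, a) <#\<^bsub>P\<^esub> carrier P"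
        have "v p \<otimes> e X \<otimes> (v p)\<^sup>\<star> = t w \<otimes> (s c \<otimes> t.range_proj u \<otimes> (s c)\<^sup>\<star>) \<otimes> (t w)\<^sup>\<star>"
          unfolding X e_P[OF u a] using wc u
          by (simp add: v_def closed t.range_proj_closed s.adj_mult s.mult_assoc)
        also have "\<dots> = t.range_proj (w \<otimes>\<^bsub>U\<^esub> act c u)"
          unfolding conj_s[OF wc(3) u] using wc u by (simp add: t.range_proj_mult)
        also have "\<dots> = e ((p \<otimes>\<^bsub>P\<^esub> (u, a)) <#\<^bsub>P\<^esub> carrier P)"
          using e_P[of "w \<otimes>\<^bsub>U\<^esub> act c u" "res c u \<otimes>\<^bsub>A\<^esub> a"] wc u a by simp
        also have "(p \<otimes>\<^bsub>P\<^esub> (u, a)) <#\<^bsub>P\<^esub> carrier P = p <#\<^bsub>P\<^esub> X"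
          using P.translate_principal[OF p, of "(u, a)"] u a X by simp
        finally show ?thesis .
      qed
    qed
    show "e X \<otimes> e Y = e (X \<inter> Y)" if Y: "Y \<in> constructible_ideals P" for Y
    proof (cases "X = {} \<or> Y = {}")
      case True
      then show ?thesis
        using e_closed[OF X] e_closed[OF Y] by (auto simp: e_empty)
    next
      case False
      obtain u a where u: "u \<in> carrier U" "a \<in> carrier A" "X = (u, a) <#\<^bsub>P\<^esub> carrier P"
        using P_constructible_cases[OF X] False by blast
      obtain w b where w: "w \<in> carrier U" "b \<in> carrier A" "Y = (w, b) <#\<^bsub>P\<^esub> carrier P"
        using P_constructible_cases[OF Y] False by blast
      show ?thesis
      proof (cases "(u <#\<^bsub>U\<^esub> carrier U) \<inter> (w <#\<^bsub>U\<^esub> carrier U) = {}")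
        case True
        then have "X \<inter> Y = {}"
          using P_principal_disjoint_iff[OF u(1) w(1) u(2) w(2)] u(3) w(3) by simp
        then show ?thesis
          using t.range_proj_disjoint[OF u(1) w(1) True] u w by (simp add: e_P e_empty)
      next
        case False
        then obtain r where r: "r \<in> carrier U"
            "(u <#\<^bsub>U\<^esub> carrier U) \<inter> (w <#\<^bsub>U\<^esub> carrier U) = r <#\<^bsub>U\<^esub> carrier U"
          using right_lcm_semigroup_principal_inter[OF U_right_lcm u(1) w(1)] by blast
        then obtain c where "c \<in> carrier A" "X \<inter> Y = (r, c) <#\<^bsub>P\<^esub> carrier P"
          using P_principal_inter[OF u(1) w(1) u(2) w(2)] u(3) w(3) by blast
        then show ?thesis
          using t.range_proj_inter[OF U.monoid_axioms u(1) w(1) r] u w r(1) by (simp add: e_P)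
      qed
    qed
  next
    fix F ps
    assume F: "foundation_set P F" "set ps = F" "distinct ps"
    have FP: "F \<subseteq> carrier P" "finite F"
      using F(1) by (simp_all only: foundation_set_def)
    then have FU: "foundation_set U (fst ` F)" "fst ` F \<subseteq> carrier U"
      using foundation_set_fst_iff[OF FP] F(1) by auto
    have "defect_product B (\<lambda>p. e (p <#\<^bsub>P\<^esub> carrier P)) ps
        = defect_product B (\<lambda>p. t.range_proj (fst p)) ps"
      using FP F(2) e_P by (intro defect_product_cong) auto
    also have "\<dots> = defect_product B t.range_proj (map fst ps)"
      by (simp only: defect_product_map)
    also have "\<dots> = defect_product B t.range_proj (remdups (map fst ps))"
      using FU(2) F(2)
      by (intro s.defect_product_remdups[symmetric] t.range_proj_closed t.range_proj_idem
          t.range_proj_comm[OF U_right_lcm]) auto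
    also have "\<dots> = \<zero>"
      using Q2[OF FU(1), of "remdups (map fst ps)"] F(2) by (simp add: t.range_proj_def[abs_def])
    finally show "defect_product B (\<lambda>p. e (p <#\<^bsub>P\<^esub> carrier P)) ps = \<zero>" .
  qed
  then show ?thesis
    by (intro exI[of _ v] exI[of _ e]) (simp add: v_def)
qed

definition matching :: "'b cstar \<Rightarrow> ('u \<times> 'a \<Rightarrow> 'b) \<Rightarrow> (('u \<times> 'a) set \<Rightarrow> 'b)
    \<Rightarrow> ('a \<Rightarrow> 'b) \<Rightarrow> ('u \<Rightarrow> 'b) \<Rightarrow> bool" where
  "matching B v e s t \<longleftrightarrow>
     boundary_relations P B v e \<and> zappa_szep_relations U A act res B s t \<and>
     (\<forall>u\<in>carrier U. \<forall>a\<in>carrier A. v (u, a) = t u \<otimes>\<^bsub>B\<^esub> s a)"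

text \<open>The values \<open>v (u, 1)\<close> and \<open>v (1, a)\<close> recover \<open>t\<close> and \<open>s\<close> because isometric
  representations are unital, so each side of a matching determines the other up to values outside
  the carriers and outside \<open>\<J>(P)\<close>.\<close>

lemma matchingD:
  fixes B :: "'b cstar" (structure)
  assumes "matching B v e s t"
  shows "boundary_relations P B v e" "zappa_szep_relations U A act res B s t"
    and "\<lbrakk>u \<in> carrier U; a \<in> carrier A\<rbrakk> \<Longrightarrow> v (u, a) = t u \<otimes> s a"
    and "a \<in> carrier A \<Longrightarrow> s a = v (\<one>\<^bsub>U\<^esub>, a)"
    and "u \<in> carrier U \<Longrightarrow> t u = v (u, \<one>\<^bsub>A\<^esub>)"
proof -
  show b: "boundary_relations P B v e" and z: "zappa_szep_relations U A act res B s t"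
    and v: "\<lbrakk>u \<in> carrier U; a \<in> carrier A\<rbrakk> \<Longrightarrow> v (u, a) = t u \<otimes> s a" for u a
    using assms unfolding matching_def by blast+
  interpret zappa_szep_relations U A act res B s t by (rule z)
  show "s a = v (\<one>\<^bsub>U\<^esub>, a)" if "a \<in> carrier A"
    using that by (simp add: v t.rep_one[OF U.monoid_axioms] s.rep_closed)
  show "t u = v (u, \<one>\<^bsub>A\<^esub>)" if "u \<in> carrier U"
    using that by (simp add: v s.rep_one[OF A.monoid_axioms] t.rep_closed)
qed

lemma ex_matching_of_boundary:
  assumes "boundary_relations P B v e"
  shows "\<exists>s t. matching B v e s t"
  using assms boundary_imp_zappa_szep_relations[OF assms] unfolding matching_def by blast

lemma ex_matching_of_relations:
  assumes "zappa_szep_relations U A act res B s t"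
  shows "\<exists>v e. matching B v e s t"
  using assms zappa_szep_relations_imp_boundary[OF assms] unfolding matching_def by blast

lemma matching_identification:
  assumes "matching B v e s t"
  shows "zappa_szep_identification U A act res B v e s t"
proof -
  note m = matchingD[OF assms]
  interpret b: boundary_relations P B v e by (rule m(1))
  interpret z: zappa_szep_relations U A act res B s t by (rule m(2))
  show ?thesis
    unfolding zappa_szep_identification_def Let_def
  proof (intro ballI conjI)
    fix u a assume c: "u \<in> carrier U" "a \<in> carrier A"
    show "v (u, a) = t u \<otimes>\<^bsub>B\<^esub> s a"
      by (rule m(3)[OF c])
    then show "e ((u, a) <#\<^bsub>P\<^esub> carrier P)
        = t u \<otimes>\<^bsub>B\<^esub> s a \<otimes>\<^bsub>B\<^esub> (s a)\<^sup>\<star>\<^bsub>B\<^esub> \<otimes>\<^bsub>B\<^esub> (t u)\<^sup>\<star>\<^bsub>B\<^esub>"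
      using b.e_principal[of "(u, a)"] c
      by (simp add: z.s.rep_closed z.t.rep_closed b.adj_closed b.adj_mult b.mult_assoc)
  qed
qed

text \<open>Each family is obtained from the other by products and adjoints, as
  \<open>e\<^bsub>(u, a)P\<^esub> = v\<^bsub>(u, a)\<^esub> v\<^bsub>(u, a)\<^esub>\<^sup>*\<close>, and \<open>e\<^bsub>\<emptyset>\<^esub> = 0\<close>. Hence a subalgebra contains both or
  neither, and likewise a *-homomorphism respects both or neither.\<close>

lemma matching_subalgebra_iff:
  assumes "matching B v e s t" and D: "cstar_subalgebra B D"
  shows "v ` carrier P \<union> e ` constructible_ideals P \<subseteq> D \<longleftrightarrow> s ` carrier A \<union> t ` carrier U \<subseteq> D"
proof
  note m = matchingD[OF assms(1)]
  interpret b: boundary_relations P B v e by (rule m(1))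
  show "s ` carrier A \<union> t ` carrier U \<subseteq> D" if "v ` carrier P \<union> e ` constructible_ideals P \<subseteq> D"
    using that m(4,5) by auto
  assume S: "s ` carrier A \<union> t ` carrier U \<subseteq> D"
  have v: "v p \<in> D" if p: "p \<in> carrier P" for p
  proof -
    obtain u a where ua: "p = (u, a)" "u \<in> carrier U" "a \<in> carrier A"
      using p by (auto simp: carrier_zappa_szep)
    then have "t u \<in> D" "s a \<in> D"
      using S by auto
    then show ?thesis
      using D ua by (simp add: m(3) cstar_subalgebra_def)
  qed
  have "e X \<in> D" if X: "X \<in> constructible_ideals P" for X
  proof (rule P_constructible_cases[OF X])
    assume "X = {}"
    then show ?thesis
      using D by (simp add: b.e_empty cstar_subalgebra_def)
  next
    fix u a assume "u \<in> carrier U" "a \<in> carrier A" and X: "X = (u, a) <#\<^bsub>P\<^esub> carrier P"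
    then have p: "(u, a) \<in> carrier P" by simp
    show ?thesis
      unfolding X b.e_principal[OF p] using v[OF p] D unfolding cstar_subalgebra_def by blast
  qed
  with v show "v ` carrier P \<union> e ` constructible_ideals P \<subseteq> D" by blast
qed

lemma matching_generated_iff:
  assumes "matching B v e s t"
  shows "cstar_generated_by B (v ` carrier P \<union> e ` constructible_ideals P)
    \<longleftrightarrow> cstar_generated_by B (s ` carrier A \<union> t ` carrier U)"
proof -
  interpret b: boundary_relations P B v e by (rule matchingD[OF assms])
  interpret z: zappa_szep_relations U A act res B s t by (rule matchingD[OF assms])
  have "v ` carrier P \<union> e ` constructible_ideals P \<subseteq> carrier B"
    using b.rep_closed b.e_closed by blast
  moreover have "s ` carrier A \<union> t ` carrier U \<subseteq> carrier B"
    using z.s.rep_closed z.t.rep_closed by blast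
  ultimately show ?thesis
    unfolding cstar_generated_by_def
    by (simp only: matching_subalgebra_iff[OF assms] cong: conj_cong)
qed

lemma matching_hom_iff:
  assumes Q: "matching Q v e s t" and B: "matching B v' e' s' t'" and \<phi>: "\<phi> \<in> cstar_hom Q B"
  shows "(\<forall>p\<in>carrier P. \<phi> (v p) = v' p) \<and> (\<forall>X\<in>constructible_ideals P. \<phi> (e X) = e' X)
    \<longleftrightarrow> (\<forall>a\<in>carrier A. \<phi> (s a) = s' a) \<and> (\<forall>u\<in>carrier U. \<phi> (t u) = t' u)" (is "?V \<longleftrightarrow> ?S")
proof
  note mQ = matchingD[OF Q] and mB = matchingD[OF B]
  interpret Q: boundary_relations P Q v e by (rule mQ(1))
  interpret B: boundary_relations P B v' e' by (rule mB(1))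
  interpret zQ: zappa_szep_relations U A act res Q s t by (rule mQ(2))
  have hom: "\<phi> \<in> ring_hom Q B" and adj: "x \<in> carrier Q \<Longrightarrow> \<phi> (x\<^sup>\<star>\<^bsub>Q\<^esub>) = (\<phi> x)\<^sup>\<star>\<^bsub>B\<^esub>" for x
    using \<phi> by (simp_all add: cstar_hom_def)
  show ?S if ?V
    using that by (simp add: mQ(4,5) mB(4,5))
  assume S: ?S
  have v: "\<phi> (v p) = v' p" if p: "p \<in> carrier P" for p
  proof -
    obtain u a where "p = (u, a)" "u \<in> carrier U" "a \<in> carrier A"
      using p by (auto simp: carrier_zappa_szep)
    then show ?thesis
      using S by (simp add: mQ(3) mB(3) ring_hom_mult[OF hom] zQ.s.rep_closed zQ.t.rep_closed)
  qed
  have "\<phi> (e X) = e' X" if X: "X \<in> constructible_ideals P" for X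
  proof (rule P_constructible_cases[OF X])
    assume "X = {}"
    then show ?thesis
      using ring_hom_zero[OF hom Q.B_ring B.B_ring] by (simp add: Q.e_empty B.e_empty)
  next
    fix u a assume "u \<in> carrier U" "a \<in> carrier A" and X: "X = (u, a) <#\<^bsub>P\<^esub> carrier P"
    then have p: "(u, a) \<in> carrier P" by simp
    show ?thesis
      unfolding X Q.e_principal[OF p] B.e_principal[OF p]
      using p by (simp only: ring_hom_mult[OF hom] adj v Q.rep_closed Q.adj_closed)
  qed
  with v show ?V by blast
qed

text \<open>Test algebras with a solution of one system are test algebras with a matching solution of the
  other, and the same homomorphisms are compatible with either.\<close>

lemma matching_universal_iff:
  fixes Q :: "'q cstar"
  assumes Q: "matching Q v e s t"
  shows "is_boundary_quotient TYPE('b) P Q v e \<longleftrightarrow> is_universal_zappa_szep TYPE('b) U A act res Q s t"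
proof -
  let ?V = "\<lambda>(B :: 'b cstar) v' e' \<phi>.
    (\<forall>p\<in>carrier P. \<phi> (v p) = v' p) \<and> (\<forall>X\<in>constructible_ideals P. \<phi> (e X) = e' X)"
  let ?S = "\<lambda>(B :: 'b cstar) s' t' \<phi>.
    (\<forall>a\<in>carrier A. \<phi> (s a) = s' a) \<and> (\<forall>u\<in>carrier U. \<phi> (t u) = t' u)"
  define ex1 where "ex1 B K \<longleftrightarrow> (\<exists>\<phi>\<in>cstar_hom Q B. K \<phi> \<and>
    (\<forall>\<psi>\<in>cstar_hom Q B. K \<psi> \<longrightarrow> (\<forall>x\<in>carrier Q. \<psi> x = \<phi> x)))" for B :: "'b cstar" and K
  have ex1_iff: "ex1 B (?V B v' e') \<longleftrightarrow> ex1 B (?S B s' t')" if "matching B v' e' s' t'" for B v' e' s' t'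
    unfolding ex1_def by (simp only: matching_hom_iff[OF Q that] cong: bex_cong ball_cong)
  have bq: "is_boundary_quotient TYPE('b) P Q v e \<longleftrightarrow>
      cstar_generated_by Q (v ` carrier P \<union> e ` constructible_ideals P) \<and>
      (\<forall>(B :: 'b cstar) v' e'. boundary_relations P B v' e' \<longrightarrow> ex1 B (?V B v' e'))"
    unfolding is_boundary_quotient_def ex1_def conj_assoc using matchingD(1)[OF Q] by simp
  have zs: "is_universal_zappa_szep TYPE('b) U A act res Q s t \<longleftrightarrow>
      cstar_generated_by Q (s ` carrier A \<union> t ` carrier U) \<and>
      (\<forall>(B :: 'b cstar) s' t'. zappa_szep_relations U A act res B s' t' \<longrightarrow> ex1 B (?S B s' t'))"
    unfolding is_universal_zappa_szep_def ex1_def conj_assoc using matchingD(2)[OF Q] by simp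
  have "(\<forall>(B :: 'b cstar) v' e'. boundary_relations P B v' e' \<longrightarrow> ex1 B (?V B v' e'))
      \<longleftrightarrow> (\<forall>(B :: 'b cstar) s' t'. zappa_szep_relations U A act res B s' t' \<longrightarrow> ex1 B (?S B s' t'))"
  proof (intro iffI allI impI)
    fix B :: "'b cstar" and s' t'
    assume V: "\<forall>(B :: 'b cstar) v' e'. boundary_relations P B v' e' \<longrightarrow> ex1 B (?V B v' e')"
      and "zappa_szep_relations U A act res B s' t'"
    then obtain v' e' where m: "matching B v' e' s' t'"
      using ex_matching_of_relations by blast
    show "ex1 B (?S B s' t')"
      using V matchingD(1)[OF m] unfolding ex1_iff[OF m, symmetric] by simp
  next
    fix B :: "'b cstar" and v' e'
    assume S: "\<forall>(B :: 'b cstar) s' t'. zappa_szep_relations U A act res B s' t' \<longrightarrow> ex1 B (?S B s' t')"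
      and "boundary_relations P B v' e'"
    then obtain s' t' where m: "matching B v' e' s' t'"
      using ex_matching_of_boundary by blast
    show "ex1 B (?V B v' e')"
      using S matchingD(2)[OF m] unfolding ex1_iff[OF m] by simp
  qed
  then show ?thesis
    unfolding bq zs matching_generated_iff[OF Q] by simp
qed

end

theorem theorem5p2:
  fixes U :: "'u monoid" and A :: "'a monoid"
    and act :: "'a \<Rightarrow> 'u \<Rightarrow> 'u" and res :: "'a \<Rightarrow> 'u \<Rightarrow> 'a"
  assumes "zappa_szep_pair U A act res"
    and "right_lcm_semigroup U"
    and "left_cancellative A"
    and "\<forall>X\<in>constructible_ideals A. \<forall>Y\<in>constructible_ideals A. X \<subseteq> Y \<or> Y \<subseteq> X"
    and "\<forall>a\<in>carrier A. bij_betw (act a) (carrier U) (carrier U)"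
  shows "(\<forall>(Q :: 'q cstar) v e.
            is_boundary_quotient TYPE('b) (zappa_szep U A act res) Q v e \<longrightarrow>
            (\<exists>s t. is_universal_zappa_szep TYPE('b) U A act res Q s t \<and>
                   zappa_szep_identification U A act res Q v e s t)) \<and>
         (\<forall>(Q :: 'q cstar) s t.
            is_universal_zappa_szep TYPE('b) U A act res Q s t \<longrightarrow>
            (\<exists>v e. is_boundary_quotient TYPE('b) (zappa_szep U A act res) Q v e \<and>
                   zappa_szep_identification U A act res Q v e s t))"
proof -
  interpret Z: zappa_szep_pair U A act res by fact
  interpret right_lcm_zappa_szep U A act res
    using assms(2-5) Z.A.principal_constructible by unfold_locales simp_all
  show ?thesis
  proof (intro conjI allI impI)
    fix Q :: "'q cstar" and v e
    assume q: "is_boundary_quotient TYPE('b) P Q v e"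
    then have "boundary_relations P Q v e"
      unfolding is_boundary_quotient_def by (rule conjunct1)
    then obtain s t where m: "matching Q v e s t"
      using ex_matching_of_boundary by blast
    show "\<exists>s t. is_universal_zappa_szep TYPE('b) U A act res Q s t \<and>
        zappa_szep_identification U A act res Q v e s t"
      using q matching_universal_iff[OF m] matching_identification[OF m] by blast
  next
    fix Q :: "'q cstar" and s t
    assume z: "is_universal_zappa_szep TYPE('b) U A act res Q s t"
    then have "zappa_szep_relations U A act res Q s t"
      unfolding is_universal_zappa_szep_def by (rule conjunct1)
    then obtain v e where m: "matching Q v e s t"
      using ex_matching_of_relations by blast
    show "\<exists>v e. is_boundary_quotient TYPE('b) P Q v e \<and>
        zappa_szep_identification U A act res Q v e s t"
      using z matching_universal_iff[OF m] matching_identification[OF m] by blast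
  qed
qed

end
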